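(* Let $(a_n)_{n\in\mathbb{N}}$ and $(b_{n,j})_{n,j\in\mathbb{N}}$ be any real numbers with $a_n\ge 0$ for all $n$, $b_{n,j}\ge 0$ for all $n,j$, and $b_{n,j}=0$ whenever $n\ge j$. Then there exists a weight $w=(w_n)_{n=1}^\infty$ such that $A^{(w)}+B^{(w)}$ is the generator of an analytic, substochastic $C_0$-semigroup on $\ell_w^1$. If, in addition, $\sum_{n=1}^{j-1}nb_{n,j}\le j$ for all $j=2,3,\ldots$, then one can choose $w_n=r^n$ ($n\in\mathbb{N}$) with arbitrary $r>2$ and $\kappa=2/r$, so that $\sum_{n=1}^{j-1}w_nb_{n,j}\le\kappa w_j$ for all $j=2,3,\ldots$.
   Context: $\mathbb{N}=\{1,2,\ldots\}$. A weight is a sequence $w=(w_n)_{n=1}^\infty$ of strictly positive reals, and $\ell_w^1$ is the Banach space of sequences $f=(f_n)_{n=1}^\infty$ with $\|f\|_w=\sum_{n=1}^\infty w_n|f_n|<\infty$; when dealing with analyticity the complex version of $\ell_w^1$ is used. The positive cone $(\ell_w^1)_+$ consists of the sequences in $\ell_w^1$ with all entries $\ge0$. Operators: $A^{(w)}f=(-a_nf_n)_{n=1}^\infty$ with $\mathcal{D}(A^{(w)})=\{f\in\ell_w^1:(a_nf_n)_n\in\ell_w^1\}$; $B^{(w)}f=\bigl(\sum_{j=n+1}^\infty a_jb_{n,j}f_j\bigr)_{n=1}^\infty$ with $\mathcal{D}(B^{(w)})$ the set of $f\in\ell_w^1$ for which this sequence is well defined and lies in $\ell_w^1$; $A^{(w)}+B^{(w)}$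 has domain $\mathcal{D}(A^{(w)})\cap\mathcal{D}(B^{(w)})$. A $C_0$-semigroup $(S(t))_{t\ge0}$ on $\ell_w^1$ is substochastic if each $S(t)$ maps $(\ell_w^1)_+$ into itself and $\|S(t)f\|_w\le\|f\|_w$ for all $t\ge0$, $f\in(\ell_w^1)_+$. *)

theory Defs
  imports "HOL-Analysis.Analysis"
begin

text \<open>
  A sequence \<open>(f\<^sub>n)\<close> with \<open>n = 1, 2, \<dots>\<close> is a function on \<open>nat\<close> of which only the values at
  \<open>n \<ge> 1\<close> matter; elements of a sequence space are normalised by \<open>f 0 = 0\<close>, so that equality of
  sequences is equality of functions. The values at index 0 of weights and coefficients are ignored.
  The scalars \<open>'a\<close> are instantiated to \<open>real\<close> or \<open>complex\<close>. All spaces depend on a weight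
  over which the theorem quantifies, so they are sets of functions and not types.
\<close>

definition weight :: "(nat \<Rightarrow> real) \<Rightarrow> bool" where
  "weight w \<longleftrightarrow> (\<forall>n\<ge>1. 0 < w n)"

definition l1w :: "(nat \<Rightarrow> real) \<Rightarrow> (nat \<Rightarrow> 'a::real_normed_field) set" where
  "l1w w = {f. f 0 = 0 \<and> (\<lambda>n. w n * norm (f n)) summable_on {1..}}"

definition l1w_norm :: "(nat \<Rightarrow> real) \<Rightarrow> (nat \<Rightarrow> 'a::real_normed_field) \<Rightarrow> real" where
  "l1w_norm w f = (\<Sum>\<^sub>\<infinity>n\<in>{1..}. w n * norm (f n))"

definition l1w_cone :: "(nat \<Rightarrow> real) \<Rightarrow> (nat \<Rightarrow> 'a::real_normed_field) set" where
  "l1w_cone w = {f \<in> l1w w. \<forall>n\<ge>1. f n \<in> \<real>\<^sub>\<ge>\<^sub>0}"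

subsection \<open>Bounded operators, semigroups and generators\<close>

text \<open>Operators on the space are total functions whose values outside it are irrelevant.\<close>

definition bounded_op ::
  "(nat \<Rightarrow> real) \<Rightarrow> ((nat \<Rightarrow> 'a::real_normed_field) \<Rightarrow> (nat \<Rightarrow> 'a)) \<Rightarrow> bool" where
  "bounded_op w T \<longleftrightarrow>
     (\<forall>f\<in>l1w w. T f \<in> l1w w) \<and>
     (\<forall>f\<in>l1w w. \<forall>g\<in>l1w w. T (\<lambda>n. f n + g n) = (\<lambda>n. T f n + T g n)) \<and>
     (\<forall>c. \<forall>f\<in>l1w w. T (\<lambda>n. c * f n) = (\<lambda>n. c * T f n)) \<and>
     (\<exists>K. \<forall>f\<in>l1w w. l1w_norm w (T f) \<le> K * l1w_norm w f)"

definition op_norm ::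
  "(nat \<Rightarrow> real) \<Rightarrow> ((nat \<Rightarrow> 'a::real_normed_field) \<Rightarrow> (nat \<Rightarrow> 'a)) \<Rightarrow> real" where
  "op_norm w T = (SUP f\<in>{f \<in> l1w w. l1w_norm w f \<le> 1}. l1w_norm w (T f))"

definition C0_semigroup ::
  "(nat \<Rightarrow> real) \<Rightarrow> (real \<Rightarrow> (nat \<Rightarrow> 'a::real_normed_field) \<Rightarrow> (nat \<Rightarrow> 'a)) \<Rightarrow> bool" where
  "C0_semigroup w S \<longleftrightarrow>
     (\<forall>t\<ge>0. bounded_op w (S t)) \<and>
     (\<forall>f\<in>l1w w. S 0 f = f) \<and>
     (\<forall>s\<ge>0. \<forall>t\<ge>0. \<forall>f\<in>l1w w. S (s + t) f = S s (S t f)) \<and>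
     (\<forall>f\<in>l1w w. ((\<lambda>t. l1w_norm w (\<lambda>n. S t f n - f n)) \<longlongrightarrow> 0) (at_right 0))"

text \<open>The operator \<open>G\<close> with domain \<open>D\<close> and the infinitesimal generator of \<open>S\<close> have the same
  graph; in particular the domains are equal.\<close>

definition is_generator ::
  "(nat \<Rightarrow> real) \<Rightarrow> (nat \<Rightarrow> 'a::real_normed_field) set \<Rightarrow> ((nat \<Rightarrow> 'a) \<Rightarrow> (nat \<Rightarrow> 'a)) \<Rightarrow>
    (real \<Rightarrow> (nat \<Rightarrow> 'a) \<Rightarrow> (nat \<Rightarrow> 'a)) \<Rightarrow> bool" where
  "is_generator w D G S \<longleftrightarrow>
     (\<forall>f g. (f \<in> D \<and> g = G f) \<longleftrightarrow>
        (f \<in> l1w w \<and> g \<in> l1w w \<and>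
         ((\<lambda>h. l1w_norm w (\<lambda>n. (1 / h) *\<^sub>R (S h f n - f n) - g n)) \<longlongrightarrow> 0) (at_right 0)))"

definition substochastic ::
  "(nat \<Rightarrow> real) \<Rightarrow> (real \<Rightarrow> (nat \<Rightarrow> 'a::real_normed_field) \<Rightarrow> (nat \<Rightarrow> 'a)) \<Rightarrow> bool" where
  "substochastic w S \<longleftrightarrow>
     (\<forall>t\<ge>0. \<forall>f\<in>l1w_cone w. S t f \<in> l1w_cone w \<and> l1w_norm w (S t f) \<le> l1w_norm w f)"

definition sector :: "real \<Rightarrow> complex set" where
  "sector \<delta> = {z. z \<noteq> 0 \<and> \<bar>Arg z\<bar> < \<delta>}"

text \<open>\<open>S\<close> extends to a semigroup on an open sector around the positive half-axis that is holomorphic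
  with respect to the operator norm and strongly continuous at 0.\<close>

definition analytic_semigroup ::
  "(nat \<Rightarrow> real) \<Rightarrow> (real \<Rightarrow> (nat \<Rightarrow> complex) \<Rightarrow> (nat \<Rightarrow> complex)) \<Rightarrow> bool" where
  "analytic_semigroup w S \<longleftrightarrow>
     (\<exists>\<delta> T. 0 < \<delta> \<and> \<delta> \<le> pi / 2 \<and>
        (\<forall>t>0. \<forall>f\<in>l1w w. T (complex_of_real t) f = S t f) \<and>
        (\<forall>z\<in>sector \<delta>. bounded_op w (T z)) \<and>
        (\<forall>z1\<in>sector \<delta>. \<forall>z2\<in>sector \<delta>. \<forall>f\<in>l1w w. T (z1 + z2) f = T z1 (T z2 f)) \<and>
        (\<forall>z\<in>sector \<delta>. \<exists>T'. bounded_op w T' \<and>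
           ((\<lambda>h. op_norm w (\<lambda>f n. (T (z + h) f n - T z f n) / h - T' f n)) \<longlongrightarrow> 0) (at 0)) \<and>
        (\<forall>f\<in>l1w w. ((\<lambda>z. l1w_norm w (\<lambda>n. T z f n - f n)) \<longlongrightarrow> 0) (at 0 within sector \<delta>)))"

subsection \<open>The fragmentation operators\<close>

definition A_op :: "(nat \<Rightarrow> real) \<Rightarrow> (nat \<Rightarrow> 'a::real_normed_field) \<Rightarrow> (nat \<Rightarrow> 'a)" where
  "A_op a f = (\<lambda>n. - (of_real (a n) * f n))"

definition A_dom :: "(nat \<Rightarrow> real) \<Rightarrow> (nat \<Rightarrow> real) \<Rightarrow> (nat \<Rightarrow> 'a::real_normed_field) set" where
  "A_dom w a = {f \<in> l1w w. (\<lambda>n. of_real (a n) * f n) \<in> l1w w}"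

definition B_term ::
  "(nat \<Rightarrow> real) \<Rightarrow> (nat \<Rightarrow> nat \<Rightarrow> real) \<Rightarrow> (nat \<Rightarrow> 'a::real_normed_field) \<Rightarrow> nat \<Rightarrow> nat \<Rightarrow> 'a" where
  "B_term a b f n j = of_real (a j) * of_real (b n j) * f j"

text \<open>The series over \<open>j = n + 1, n + 2, \<dots>\<close> is written with \<open>j = n + 1 + i\<close>, \<open>i = 0, 1, \<dots>\<close>.\<close>

definition B_op ::
  "(nat \<Rightarrow> real) \<Rightarrow> (nat \<Rightarrow> nat \<Rightarrow> real) \<Rightarrow> (nat \<Rightarrow> 'a::real_normed_field) \<Rightarrow> (nat \<Rightarrow> 'a)" where
  "B_op a b f = (\<lambda>n. if n = 0 then 0 else (\<Sum>i. B_term a b f n (n + 1 + i)))"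

definition B_dom ::
  "(nat \<Rightarrow> real) \<Rightarrow> (nat \<Rightarrow> real) \<Rightarrow> (nat \<Rightarrow> nat \<Rightarrow> real) \<Rightarrow> (nat \<Rightarrow> 'a::real_normed_field) set" where
  "B_dom w a b =
     {f \<in> l1w w. (\<forall>n\<ge>1. summable (\<lambda>i. B_term a b f n (n + 1 + i))) \<and> B_op a b f \<in> l1w w}"

definition AB_op ::
  "(nat \<Rightarrow> real) \<Rightarrow> (nat \<Rightarrow> nat \<Rightarrow> real) \<Rightarrow> (nat \<Rightarrow> 'a::real_normed_field) \<Rightarrow> (nat \<Rightarrow> 'a)" where
  "AB_op a b f = (\<lambda>n. A_op a f n + B_op a b f n)"

definition AB_dom ::
  "(nat \<Rightarrow> real) \<Rightarrow> (nat \<Rightarrow> real) \<Rightarrow> (nat \<Rightarrow> nat \<Rightarrow> real) \<Rightarrow> (nat \<Rightarrow> 'a::real_normed_field) set" where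
  "AB_dom w a b = A_dom w a \<inter> B_dom w a b"

text \<open>Analyticity is a statement about the complex space. The semigroups generated on the real and
  on the complex space are both included.\<close>

definition generates_analytic_substochastic ::
  "(nat \<Rightarrow> real) \<Rightarrow> (nat \<Rightarrow> real) \<Rightarrow> (nat \<Rightarrow> nat \<Rightarrow> real) \<Rightarrow> bool" where
  "generates_analytic_substochastic w a b \<longleftrightarrow>
     (\<exists>S :: real \<Rightarrow> (nat \<Rightarrow> real) \<Rightarrow> (nat \<Rightarrow> real).
        C0_semigroup w S \<and> is_generator w (AB_dom w a b) (AB_op a b) S \<and> substochastic w S) \<and>
     (\<exists>S :: real \<Rightarrow> (nat \<Rightarrow> complex) \<Rightarrow> (nat \<Rightarrow> complex).
        C0_semigroup w S \<and> is_generator w (AB_dom w a b) (AB_op a b) S \<and> substochastic w S \<and>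
        analytic_semigroup w S)"

end

theory Submission
  imports Defs "HOL-Complex_Analysis.Complex_Analysis"
begin

text \<open>
  If \<open>\<Sum>n<j. w n * b n j \<le> \<kappa> * w j\<close> with \<open>\<kappa> < 1\<close>, everything can be read off the columns of the
  matrix \<open>M\<close> of \<open>A + B\<close>. Being upper triangular, \<open>M\<close> has an entrywise entire exponential
  \<open>E z\<close>. An operator on a weighted \<open>l1\<close> space is bounded iff its columns are, and integrating the
  equation for column \<open>j\<close> along rays shows, by induction on \<open>j\<close>, that every column of \<open>E z\<close> is
  contracted whenever \<open>\<kappa> * \<bar>z\<bar> < Re z\<close>. Dominated convergence over the columns gives strong
  continuity and the derivative at 0 on the domain of \<open>A\<close>, and Cauchy's estimates give holomorphy
  in operator norm. Conversely, \<open>\<parallel>f\<parallel> \<le> \<parallel>S h f\<parallel> + \<parallel>S h f - f\<parallel>\<close> together with a loss of at least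
  \<open>(1 - \<kappa>) * (1 - exp (- a j * h)) * w j\<close> in column \<open>j\<close> of \<open>S h\<close> bounds
  \<open>(1 - \<kappa>) * (\<Sum>j. a j * w j * \<bar>f j\<bar>)\<close> by the norm of the generator at \<open>f\<close>, so the generator
  has no larger domain than \<open>A\<close>.
\<close>

section \<open>Weighted sequence spaces\<close>

lemma weightD: "weight w \<Longrightarrow> n \<ge> 1 \<Longrightarrow> 0 < w n"
  by (simp add: weight_def)

lemma weight_nonneg: "weight w \<Longrightarrow> n \<ge> 1 \<Longrightarrow> 0 \<le> w n"
  by (simp add: weight_def less_imp_le)

lemma l1w_summable: "f \<in> l1w w \<Longrightarrow> (\<lambda>n. w n * norm (f n)) summable_on {1..}"
  by (simp add: l1w_def)

lemma l1w_zero: "f \<in> l1w w \<Longrightarrow> f 0 = 0"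
  by (simp add: l1w_def)

lemma l1w_norm_nonneg: "weight w \<Longrightarrow> l1w_norm w f \<ge> 0"
  unfolding l1w_norm_def by (intro infsum_nonneg mult_nonneg_nonneg) (auto intro: weight_nonneg)

lemma l1w_add:
  assumes w: "weight w" and f: "f \<in> l1w w" and g: "g \<in> l1w w"
  shows "(\<lambda>n. f n + g n) \<in> l1w w"
    and "l1w_norm w (\<lambda>n. f n + g n) \<le> l1w_norm w f + l1w_norm w g"
proof -
  have s: "(\<lambda>n. w n * norm (f n) + w n * norm (g n)) summable_on {1..}"
    by (intro summable_on_add l1w_summable f g)
  have le: "w n * norm (f n + g n) \<le> w n * norm (f n) + w n * norm (g n)" if "n \<in> {1..}" for n
    using weightD[OF w, of n] that norm_triangle_ineq[of "f n" "g n"]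
    by (simp add: distrib_left[symmetric])
  have s': "(\<lambda>n. w n * norm (f n + g n)) summable_on {1..}"
    by (rule summable_on_comparison_test[OF s le]) (auto intro!: mult_nonneg_nonneg weight_nonneg[OF w])
  show "(\<lambda>n. f n + g n) \<in> l1w w"
    using s' f g by (simp add: l1w_def)
  have "l1w_norm w (\<lambda>n. f n + g n) \<le> (\<Sum>\<^sub>\<infinity>n\<in>{1..}. w n * norm (f n) + w n * norm (g n))"
    unfolding l1w_norm_def by (rule infsum_mono[OF s' s le])
  also have "\<dots> = l1w_norm w f + l1w_norm w g"
    unfolding l1w_norm_def by (intro infsum_add l1w_summable f g)
  finally show "l1w_norm w (\<lambda>n. f n + g n) \<le> l1w_norm w f + l1w_norm w g" .
qed

lemma l1w_norm_scale:
  fixes f :: "nat \<Rightarrow> 'a::real_normed_field"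
  shows "l1w_norm w (\<lambda>n. c * f n) = norm c * l1w_norm w f"
proof -
  have "l1w_norm w (\<lambda>n. c * f n) = (\<Sum>\<^sub>\<infinity>n\<in>{1..}. norm c * (w n * norm (f n)))"
    unfolding l1w_norm_def by (simp add: norm_mult mult_ac)
  then show ?thesis
    by (simp add: infsum_cmult_right' l1w_norm_def)
qed

lemma l1w_scale:
  fixes f :: "nat \<Rightarrow> 'a::real_normed_field"
  assumes "f \<in> l1w w"
  shows "(\<lambda>n. c * f n) \<in> l1w w"
proof -
  have "(\<lambda>n. norm c * (w n * norm (f n))) summable_on {1..}"
    by (intro summable_on_cmult_right l1w_summable assms)
  then show ?thesis
    using l1w_zero[OF assms] by (simp add: l1w_def norm_mult mult_ac)
qed

lemma l1w_diff:
  fixes f g :: "nat \<Rightarrow> 'a::real_normed_field"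
  assumes "weight w" "f \<in> l1w w" "g \<in> l1w w"
  shows "(\<lambda>n. f n - g n) \<in> l1w w"
    and "l1w_norm w (\<lambda>n. f n - g n) \<le> l1w_norm w f + l1w_norm w g"
  using l1w_add[OF assms(1,2) l1w_scale[OF assms(3), of "-1"]] l1w_norm_scale[of w "-1" g]
  by simp_all

lemma l1w_norm_eq_0:
  assumes w: "weight w" and f: "f \<in> l1w w" and "l1w_norm w f \<le> 0"
  shows "f = (\<lambda>n. 0)"
proof
  fix n
  show "f n = 0"
  proof (cases "n = 0")
    case False
    have "w n * norm (f n) = 0"
      by (rule nonneg_infsum_le_0D[OF assms(3)[unfolded l1w_norm_def]])
        (use l1w_summable[OF f] False in \<open>auto intro!: mult_nonneg_nonneg weight_nonneg[OF w]\<close>)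
    then show ?thesis
      using weightD[OF w, of n] False by simp
  qed (simp add: l1w_zero[OF f])
qed

section \<open>Upper triangular matrices acting on sequences\<close>

text \<open>The row index comes first. Triangularity makes every column finite, so column norms and
  the entries of matrix products are finite sums.\<close>

definition upper :: "(nat \<Rightarrow> nat \<Rightarrow> 'a::zero) \<Rightarrow> bool" where
  "upper X \<longleftrightarrow> (\<forall>n j. j < n \<longrightarrow> X n j = 0)"

text \<open>For upper triangular \<open>X\<close> this is the norm of the image of the
  \<open>j\<close>-th unit vector. A bound by a constant times \<open>w j\<close>, uniform in
  \<open>j\<close>, makes \<open>mat_app X\<close> a bounded operator.\<close>

definition col_norm :: "(nat \<Rightarrow> real) \<Rightarrow> (nat \<Rightarrow> nat \<Rightarrow> 'a::real_normed_field) \<Rightarrow> nat \<Rightarrow> real" where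
  "col_norm w X j = (\<Sum>n=1..j. w n * norm (X n j))"

text \<open>The value at index 0 is fixed by hand, in keeping with the normalisation in
  \<open>l1w\<close>.\<close>

definition mat_app :: "(nat \<Rightarrow> nat \<Rightarrow> 'a::real_normed_field) \<Rightarrow> (nat \<Rightarrow> 'a) \<Rightarrow> nat \<Rightarrow> 'a" where
  "mat_app X f n = (if n = 0 then 0 else \<Sum>\<^sub>\<infinity>j\<in>{1..}. X n j * f j)"

text \<open>The condition refers to a single \<open>f\<close> so that unbounded matrices can be
  applied as well; for the matrix of \<open>A + B\<close> it holds on the domain of
  \<open>A\<close>.\<close>

definition col_summable :: "(nat \<Rightarrow> real) \<Rightarrow> (nat \<Rightarrow> nat \<Rightarrow> 'a::real_normed_field) \<Rightarrow> (nat \<Rightarrow> 'a) \<Rightarrow> bool" where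
  "col_summable w X f \<longleftrightarrow> (\<lambda>j. col_norm w X j * norm (f j)) summable_on {1..}"

lemma upperD: "upper X \<Longrightarrow> j < n \<Longrightarrow> X n j = 0"
  by (simp add: upper_def)

lemma upper_lincomb:
  fixes X Y :: "nat \<Rightarrow> nat \<Rightarrow> 'a::real_normed_field"
  shows "upper X \<Longrightarrow> upper Y \<Longrightarrow> upper (\<lambda>n j. c * X n j + d * Y n j)"
  by (simp add: upper_def)

lemma col_norm_nonneg: "weight w \<Longrightarrow> col_norm w X j \<ge> 0"
  unfolding col_norm_def by (intro sum_nonneg mult_nonneg_nonneg) (auto intro: weight_nonneg)

lemma col_norm_lincomb:
  fixes X Y :: "nat \<Rightarrow> nat \<Rightarrow> 'a::real_normed_field"
  assumes "weight w"
  shows "col_norm w (\<lambda>n j. c * X n j + d * Y n j) j \<le> norm c * col_norm w X j + norm d * col_norm w Y j"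
proof -
  have "w n * norm (c * X n j + d * Y n j) \<le> norm c * (w n * norm (X n j)) + norm d * (w n * norm (Y n j))"
    if "n \<in> {1..j}" for n
  proof -
    have "norm (c * X n j + d * Y n j) \<le> norm c * norm (X n j) + norm d * norm (Y n j)"
      by (metis norm_mult norm_triangle_ineq)
    then show ?thesis
      using mult_left_mono[of _ _ "w n"] weightD[OF assms, of n] that
      by (fastforce simp: algebra_simps)
  qed
  then show ?thesis
    unfolding col_norm_def sum_distrib_left sum.distrib[symmetric] by (rule sum_mono)
qed

lemma col_summable_comparison:
  assumes w: "weight w" and s: "(\<lambda>j. c j * norm (f j)) summable_on {1..}"
    and le: "\<And>j. j \<ge> 1 \<Longrightarrow> col_norm w X j \<le> c j"
  shows "col_summable w X f"
  unfolding col_summable_def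
  by (rule summable_on_comparison_test[OF s]) (auto intro!: mult_right_mono mult_nonneg_nonneg le col_norm_nonneg[OF w])

lemma col_summable_bounded:
  assumes w: "weight w" and f: "f \<in> l1w w"
    and le: "\<And>j. j \<ge> 1 \<Longrightarrow> col_norm w X j \<le> C * w j"
  shows "col_summable w X f"
  by (rule col_summable_comparison[OF w _ le])
    (use summable_on_cmult_right[OF l1w_summable[OF f], of C] in \<open>simp add: mult.assoc\<close>)

lemma col_summable_lincomb:
  fixes X Y :: "nat \<Rightarrow> nat \<Rightarrow> 'a::real_normed_field"
  assumes w: "weight w" and X: "col_summable w X f" and Y: "col_summable w Y f"
  shows "col_summable w (\<lambda>n j. c * X n j + d * Y n j) f"
proof (rule col_summable_comparison[OF w _ col_norm_lincomb[OF w]])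
  have "(\<lambda>j. norm c * (col_norm w X j * norm (f j)) + norm d * (col_norm w Y j * norm (f j))) summable_on {1..}"
    using X Y by (intro summable_on_add summable_on_cmult_right) (auto simp: col_summable_def)
  then show "(\<lambda>j. (norm c * col_norm w X j + norm d * col_norm w Y j) * norm (f j)) summable_on {1..}"
    by (simp add: algebra_simps)
qed

section \<open>Convergence and norm bounds from column norms\<close>

lemma entry_le_col_norm:
  assumes w: "weight w" and X: "upper X" and n: "n \<ge> 1"
  shows "w n * norm (X n j) \<le> col_norm w X j"
proof (cases "n \<le> j")
  case True
  have "(\<Sum>i\<in>{n}. w i * norm (X i j)) \<le> col_norm w X j"
    unfolding col_norm_def
    by (rule sum_mono2) (use True n in \<open>auto intro!: mult_nonneg_nonneg weight_nonneg[OF w]\<close>)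
  then show ?thesis by simp
next
  case False
  then show ?thesis
    using upperD[OF X, of j n] col_norm_nonneg[OF w] by simp
qed

text \<open>An entry in row \<open>n\<close> is at most its column norm divided by
  \<open>w n\<close>, so the row series is dominated by the series in
  \<open>col_summable\<close>.\<close>

lemma mat_row_abs_summable:
  assumes w: "weight w" and X: "upper X" and s: "col_summable w X f" and n: "n \<ge> 1"
  shows "(\<lambda>j. norm (X n j * f j)) summable_on {1..}"
proof (rule Infinite_Sum.abs_summable_on_comparison_test')
  show "(\<lambda>j. inverse (w n) * (col_norm w X j * norm (f j))) summable_on {1..}"
    using s by (intro summable_on_cmult_right) (simp add: col_summable_def)
  fix j
  have "norm (X n j) = inverse (w n) * (w n * norm (X n j))"
    using weightD[OF w n] by simp
  also have "\<dots> \<le> inverse (w n) * col_norm w X j"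
    using weightD[OF w n] by (intro mult_left_mono entry_le_col_norm w X n) auto
  finally show "norm (X n j * f j) \<le> inverse (w n) * (col_norm w X j * norm (f j))"
    by (simp add: norm_mult mult.assoc[symmetric] mult_right_mono)
qed

lemma has_sum_finite_sum:
  fixes f :: "'i \<Rightarrow> 'k \<Rightarrow> 'a::topological_comm_monoid_add"
  assumes "finite F" "\<And>n. n \<in> F \<Longrightarrow> (f n has_sum S n) A"
  shows "((\<lambda>j. \<Sum>n\<in>F. f n j) has_sum (\<Sum>n\<in>F. S n)) A"
  using assms by (induction F rule: finite_induct) (auto intro: has_sum_add)

text \<open>Tonelli's theorem for rows and columns. With finitely many rows at a time the
  interchange is mere additivity of sums, and the resulting bound does not depend on the set of
  rows.\<close>

lemma mat_app_l1w:
  fixes X :: "nat \<Rightarrow> nat \<Rightarrow> 'a::{real_normed_field,banach}"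
  assumes w: "weight w" and X: "upper X" and s: "col_summable w X f"
  shows "mat_app X f \<in> l1w w"
    and "l1w_norm w (mat_app X f) \<le> (\<Sum>\<^sub>\<infinity>j\<in>{1..}. col_norm w X j * norm (f j))"
proof -
  let ?B = "\<Sum>\<^sub>\<infinity>j\<in>{1..}. col_norm w X j * norm (f j)"
  have fin: "(\<Sum>n\<in>F. w n * norm (mat_app X f n)) \<le> ?B" if F: "finite F" "F \<subseteq> {1..}" for F
  proof -
    have abs: "(\<lambda>j. norm (X n j * f j)) summable_on {1..}" if "n \<in> F" for n
      using mat_row_abs_summable[OF w X s, of n] F that by auto
    have "(\<Sum>n\<in>F. w n * norm (mat_app X f n)) \<le> (\<Sum>n\<in>F. w n * (\<Sum>\<^sub>\<infinity>j\<in>{1..}. norm (X n j * f j)))"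
    proof (intro sum_mono mult_left_mono)
      fix n assume n: "n \<in> F"
      then have "n \<ge> 1" using F by auto
      then show "0 \<le> w n" using weightD[OF w, of n] by simp
      show "norm (mat_app X f n) \<le> (\<Sum>\<^sub>\<infinity>j\<in>{1..}. norm (X n j * f j))"
        using norm_infsum_bound[OF abs[OF n]] \<open>n \<ge> 1\<close> by (simp add: mat_app_def)
    qed
    also have "\<dots> = (\<Sum>n\<in>F. \<Sum>\<^sub>\<infinity>j\<in>{1..}. w n * norm (X n j * f j))"
      by (simp add: infsum_cmult_right')
    also have "\<dots> = (\<Sum>\<^sub>\<infinity>j\<in>{1..}. \<Sum>n\<in>F. w n * norm (X n j * f j))"
      by (rule infsumI[symmetric], rule has_sum_finite_sum[OF F(1)], rule has_sum_infsum)
        (intro summable_on_cmult_right abs)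
    also have "\<dots> \<le> ?B"
    proof (rule infsum_mono)
      show "(\<lambda>j. \<Sum>n\<in>F. w n * norm (X n j * f j)) summable_on {1..}"
        by (rule has_sum_imp_summable, rule has_sum_finite_sum[OF F(1)], rule has_sum_infsum)
          (intro summable_on_cmult_right abs)
      show "(\<lambda>j. col_norm w X j * norm (f j)) summable_on {1..}"
        using s by (simp add: col_summable_def)
      fix j
      have nz: "n \<le> j" if "X n j \<noteq> 0" for n
        using upperD[OF X, of j n] that not_less by blast
      \<comment> \<open>Triangularity cuts \<open>F\<close> down to rows that
        \<open>col_norm\<close> counts.\<close>
      have "(\<Sum>n\<in>F. w n * norm (X n j)) = (\<Sum>n\<in>F \<inter> {1..j}. w n * norm (X n j))"
        using F by (intro sum.mono_neutral_right) (auto dest: nz)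
      also have "\<dots> \<le> col_norm w X j"
        unfolding col_norm_def
        by (rule sum_mono2) (auto intro!: mult_nonneg_nonneg weight_nonneg[OF w])
      finally have "(\<Sum>n\<in>F. w n * norm (X n j)) * norm (f j) \<le> col_norm w X j * norm (f j)"
        by (rule mult_right_mono) simp
      then show "(\<Sum>n\<in>F. w n * norm (X n j * f j)) \<le> col_norm w X j * norm (f j)"
        by (simp add: norm_mult sum_distrib_right mult.assoc)
    qed
    finally show ?thesis .
  qed
  have sm: "(\<lambda>n. w n * norm (mat_app X f n)) summable_on {1..}"
  proof (rule nonneg_bdd_above_summable_on)
    show "bdd_above (sum (\<lambda>n. w n * norm (mat_app X f n)) ` {F. F \<subseteq> {1..} \<and> finite F})"
      using fin by (intro bdd_aboveI[where M = ?B]) auto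
  qed (auto intro!: mult_nonneg_nonneg weight_nonneg[OF w])
  show "mat_app X f \<in> l1w w"
    using sm by (simp add: l1w_def mat_app_def)
  show "l1w_norm w (mat_app X f) \<le> ?B"
    unfolding l1w_norm_def by (rule infsum_le_finite_sums[OF sm fin])
qed

lemma mat_app_norm_le:
  fixes X :: "nat \<Rightarrow> nat \<Rightarrow> 'a::{real_normed_field,banach}"
  assumes w: "weight w" and X: "upper X" and f: "f \<in> l1w w"
    and le: "\<And>j. j \<ge> 1 \<Longrightarrow> col_norm w X j \<le> C * w j"
  shows "l1w_norm w (mat_app X f) \<le> C * l1w_norm w f"
proof -
  have s: "col_summable w X f" by (rule col_summable_bounded[OF w f le])
  have "l1w_norm w (mat_app X f) \<le> (\<Sum>\<^sub>\<infinity>j\<in>{1..}. col_norm w X j * norm (f j))"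
    by (rule mat_app_l1w[OF w X s])
  also have "\<dots> \<le> (\<Sum>\<^sub>\<infinity>j\<in>{1..}. C * (w j * norm (f j)))"
    using s le unfolding col_summable_def mult.assoc[symmetric]
    by (intro infsum_mono mult_right_mono)
      (use summable_on_cmult_right[OF l1w_summable[OF f], of C] in \<open>auto simp: mult.assoc\<close>)
  also have "\<dots> = C * l1w_norm w f"
    by (simp add: infsum_cmult_right' l1w_norm_def)
  finally show ?thesis .
qed

lemma mat_app_add:
  fixes X :: "nat \<Rightarrow> nat \<Rightarrow> 'a::{real_normed_field,banach}"
  assumes w: "weight w" and X: "upper X" and "col_summable w X f" "col_summable w X g"
  shows "mat_app X (\<lambda>n. f n + g n) = (\<lambda>n. mat_app X f n + mat_app X g n)"
proof
  fix n
  show "mat_app X (\<lambda>n. f n + g n) n = mat_app X f n + mat_app X g n"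
    using infsum_add[of "\<lambda>j. X n j * f j" "{1..}" "\<lambda>j. X n j * g j"]
      abs_summable_summable[OF mat_row_abs_summable[OF w X assms(3), of n]]
      abs_summable_summable[OF mat_row_abs_summable[OF w X assms(4), of n]]
    by (auto simp: mat_app_def distrib_left)
qed

lemma mat_app_scale:
  fixes X :: "nat \<Rightarrow> nat \<Rightarrow> 'a::real_normed_field"
  shows "mat_app X (\<lambda>n. c * f n) = (\<lambda>n. c * mat_app X f n)"
  by (auto simp: mat_app_def fun_eq_iff mult.left_commute infsum_cmult_right')

lemma mat_app_lincomb:
  fixes X Y :: "nat \<Rightarrow> nat \<Rightarrow> 'a::{real_normed_field,banach}"
  assumes w: "weight w" and X: "upper X" "col_summable w X f" and Y: "upper Y" "col_summable w Y f"
  shows "mat_app (\<lambda>n j. c * X n j + d * Y n j) f = (\<lambda>n. c * mat_app X f n + d * mat_app Y f n)"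
proof
  fix n
  show "mat_app (\<lambda>n j. c * X n j + d * Y n j) f n = c * mat_app X f n + d * mat_app Y f n"
  proof (cases "n = 0")
    case False
    have "(\<Sum>\<^sub>\<infinity>j\<in>{1..}. c * (X n j * f j) + d * (Y n j * f j))
        = (\<Sum>\<^sub>\<infinity>j\<in>{1..}. c * (X n j * f j)) + (\<Sum>\<^sub>\<infinity>j\<in>{1..}. d * (Y n j * f j))"
      using abs_summable_summable[OF mat_row_abs_summable[OF w X, of n]]
        abs_summable_summable[OF mat_row_abs_summable[OF w Y, of n]] False
      by (intro infsum_add summable_on_cmult_right) auto
    then show ?thesis
      using False by (simp add: mat_app_def infsum_cmult_right' algebra_simps)
  qed (simp add: mat_app_def)
qed

lemma mat_app_diff:
  fixes X Y :: "nat \<Rightarrow> nat \<Rightarrow> 'a::{real_normed_field,banach}"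
  assumes "weight w" "upper X" "col_summable w X f" "upper Y" "col_summable w Y f"
  shows "mat_app (\<lambda>n j. X n j - Y n j) f = (\<lambda>n. mat_app X f n - mat_app Y f n)"
  using mat_app_lincomb[OF assms, of 1 "-1"] by simp

section \<open>Identity matrix, bounded matrices and their products\<close>

definition id_mat :: "nat \<Rightarrow> nat \<Rightarrow> 'a::zero_neq_one" where
  "id_mat n j = of_bool (n = j)"

lemma upper_id_mat: "upper (id_mat :: nat \<Rightarrow> nat \<Rightarrow> 'a::zero_neq_one)"
  by (simp add: upper_def id_mat_def)

lemma col_norm_id_mat:
  assumes "j \<ge> 1"
  shows "col_norm w (id_mat :: nat \<Rightarrow> nat \<Rightarrow> 'a::real_normed_field) j = w j"
proof -
  have "col_norm w (id_mat :: nat \<Rightarrow> nat \<Rightarrow> 'a) j = (\<Sum>n=1..j. if n = j then w n else 0)"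
    unfolding col_norm_def id_mat_def by (intro sum.cong) auto
  then show ?thesis using assms by simp
qed

lemma mat_app_id_mat:
  assumes "f 0 = 0"
  shows "mat_app id_mat f = f"
proof
  fix n
  show "mat_app id_mat f n = f n"
  proof (cases "n = 0")
    case False
    have "(\<Sum>\<^sub>\<infinity>j\<in>{1..}. id_mat n j * f j) = (\<Sum>\<^sub>\<infinity>j\<in>{n}. f j)"
      by (rule infsum_cong_neutral) (use False in \<open>auto simp: id_mat_def\<close>)
    then show ?thesis using False by (simp add: mat_app_def)
  qed (simp add: mat_app_def assms)
qed

lemma bounded_op_mat_app:
  fixes X :: "nat \<Rightarrow> nat \<Rightarrow> 'a::{real_normed_field,banach}"
  assumes w: "weight w" and X: "upper X"
    and le: "\<And>j. j \<ge> 1 \<Longrightarrow> col_norm w X j \<le> C * w j"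
  shows "bounded_op w (mat_app X)"
  unfolding bounded_op_def
proof (intro conjI ballI allI exI)
  fix f g :: "nat \<Rightarrow> 'a" and c :: 'a
  assume f: "f \<in> l1w w"
  show "mat_app X f \<in> l1w w"
    by (rule mat_app_l1w[OF w X col_summable_bounded[OF w f le]])
  show "mat_app X (\<lambda>n. c * f n) = (\<lambda>n. c * mat_app X f n)"
    by (rule mat_app_scale)
  show "l1w_norm w (mat_app X f) \<le> C * l1w_norm w f"
    by (rule mat_app_norm_le[OF w X f le])
  assume g: "g \<in> l1w w"
  show "mat_app X (\<lambda>n. f n + g n) = (\<lambda>n. mat_app X f n + mat_app X g n)"
    by (intro mat_app_add[OF w X] col_summable_bounded[OF w _ le] f g)
qed

text \<open>Fubini's theorem for the double series over \<open>m\<close> and \<open>j\<close>. The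
  sum in the product matrix can stop at \<open>j\<close> because \<open>Y\<close> is upper
  triangular.\<close>

lemma mat_app_compose:
  fixes X Y :: "nat \<Rightarrow> nat \<Rightarrow> 'a::{real_normed_field,banach}"
  assumes w: "weight w" and X: "upper X" "\<And>j. j \<ge> 1 \<Longrightarrow> col_norm w X j \<le> C * w j"
    and Y: "upper Y" "\<And>j. j \<ge> 1 \<Longrightarrow> col_norm w Y j \<le> D * w j" and f: "f \<in> l1w w"
  shows "mat_app X (mat_app Y f) = mat_app (\<lambda>n j. \<Sum>m=1..j. X n m * Y m j) f"
proof
  fix n
  show "mat_app X (mat_app Y f) n = mat_app (\<lambda>n j. \<Sum>m=1..j. X n m * Y m j) f n"
  proof (cases "n = 0")
    case False
    then have n: "n \<ge> 1" by simp
    \<comment> \<open>With this constant row \<open>n\<close> of \<open>X\<close> is bounded by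
      \<open>K * w m\<close>, and the inner absolute sum for column \<open>j\<close> by
      \<open>K * D * w j * norm (f j)\<close>.\<close>
    define K where "K = C / w n"
    have K: "norm (X n m) \<le> K * w m" if "m \<ge> 1" for m
    proof -
      have "w n * norm (X n m) \<le> C * w m"
        using entry_le_col_norm[OF w X(1) n, of m] X(2)[OF that] by linarith
      then show ?thesis
        using weightD[OF w n] by (simp add: K_def field_simps)
    qed
    have "0 \<le> K * w n" using K[OF n] norm_ge_zero order_trans by blast
    then have K0: "K \<ge> 0" using weightD[OF w n] by (simp add: zero_le_mult_iff)
    have inner: "((\<lambda>m. c m * Y m j * f j) has_sum (\<Sum>m=1..j. c m * Y m j * f j)) {1..}" for j and c :: "nat \<Rightarrow> 'a"
      by (rule has_sum_finite_neutralI[of "{1..j}"]) (auto simp: upperD[OF Y(1)])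
    have inner_norm: "((\<lambda>m. norm (X n m * Y m j * f j)) has_sum (\<Sum>m=1..j. norm (X n m * Y m j * f j))) {1..}" for j
      by (rule has_sum_finite_neutralI[of "{1..j}"]) (auto simp: upperD[OF Y(1)])
    have "(\<lambda>p. norm (case p of (j,m) \<Rightarrow> X n m * Y m j * f j)) summable_on {1..} \<times> {1..}"
      unfolding Infinite_Sum.abs_summable_on_Sigma_iff
    proof (intro conjI ballI)
      fix j
      show "(\<lambda>m. norm (case (j, m) of (j, m) \<Rightarrow> X n m * Y m j * f j)) summable_on {1..}"
        using inner_norm[of j] by (auto simp: summable_on_def)
      have "(\<lambda>j. norm (\<Sum>m=1..j. norm (X n m * Y m j * f j))) summable_on {1..}"
      proof (rule Infinite_Sum.abs_summable_on_comparison_test')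
        show "(\<lambda>j. (K * D) * (w j * norm (f j))) summable_on {1..}"
          by (intro summable_on_cmult_right l1w_summable f)
        fix j :: nat assume j: "j \<in> {1..}"
        have "(\<Sum>m=1..j. norm (X n m * Y m j * f j)) \<le> (\<Sum>m=1..j. K * w m * norm (Y m j) * norm (f j))"
          by (auto simp: norm_mult intro!: sum_mono mult_right_mono K)
        also have "\<dots> = K * col_norm w Y j * norm (f j)"
          by (simp add: col_norm_def sum_distrib_left sum_distrib_right mult.assoc)
        also have "\<dots> \<le> K * (D * w j) * norm (f j)"
          using j Y(2)[of j] K0 by (intro mult_right_mono mult_left_mono) auto
        finally show "norm (\<Sum>m=1..j. norm (X n m * Y m j * f j)) \<le> (K * D) * (w j * norm (f j))"
          by (simp add: sum_nonneg mult.assoc)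
      qed
      then show "(\<lambda>j. norm (infsum (\<lambda>m. norm (case (j, m) of (j, m) \<Rightarrow> X n m * Y m j * f j)) {1..})) summable_on {1..}"
        unfolding prod.case infsumI[OF inner_norm] .
    qed
    then have "(\<lambda>(j,m). X n m * Y m j * f j) summable_on {1..} \<times> {1..}"
      by (rule abs_summable_summable)
    from infsum_swap_banach[OF this]
    have swap: "(\<Sum>\<^sub>\<infinity>j\<in>{1..}. \<Sum>\<^sub>\<infinity>m\<in>{1..}. X n m * Y m j * f j)
        = (\<Sum>\<^sub>\<infinity>m\<in>{1..}. \<Sum>\<^sub>\<infinity>j\<in>{1..}. X n m * Y m j * f j)" .
    have "mat_app X (mat_app Y f) n = (\<Sum>\<^sub>\<infinity>m\<in>{1..}. \<Sum>\<^sub>\<infinity>j\<in>{1..}. X n m * Y m j * f j)"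
      using False unfolding mat_app_def
      by (auto simp: mult.assoc infsum_cmult_right' intro!: infsum_cong)
    also have "\<dots> = (\<Sum>\<^sub>\<infinity>j\<in>{1..}. \<Sum>m=1..j. X n m * Y m j * f j)"
      by (simp only: swap[symmetric] infsumI[OF inner])
    also have "\<dots> = mat_app (\<lambda>n j. \<Sum>m=1..j. X n m * Y m j) f n"
      using False by (simp add: mat_app_def sum_distrib_right)
    finally show ?thesis .
  qed (simp add: mat_app_def)
qed

section \<open>Dominated convergence over the columns\<close>

lemma infsum_from_1_eq_suminf:
  fixes g :: "nat \<Rightarrow> real"
  assumes "g summable_on {1..}"
  shows "summable (\<lambda>k. g (Suc k))" "(\<Sum>\<^sub>\<infinity>j\<in>{1..}. g j) = (\<Sum>k. g (Suc k))"
proof -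
  have "(g has_sum (\<Sum>\<^sub>\<infinity>j\<in>{1..}. g j)) {1..}"
    using assms by simp
  then have "((\<lambda>k. g (Suc k)) has_sum (\<Sum>\<^sub>\<infinity>j\<in>{1..}. g j)) UNIV"
    by (subst has_sum_reindex_bij_witness[of UNIV "\<lambda>n. n - 1" Suc "{1..}" g]) auto
  then have "(\<lambda>k. g (Suc k)) sums (\<Sum>\<^sub>\<infinity>j\<in>{1..}. g j)"
    by (rule has_sum_imp_sums)
  then show "summable (\<lambda>k. g (Suc k))" "(\<Sum>\<^sub>\<infinity>j\<in>{1..}. g j) = (\<Sum>k. g (Suc k))"
    by (simp_all add: sums_iff)
qed

text \<open>Tannery's theorem with majorant \<open>c\<close>. Entrywise convergence is enough
  because each column norm is a finite sum.\<close>

lemma mat_app_tendsto_0: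
  fixes X :: "'i \<Rightarrow> nat \<Rightarrow> nat \<Rightarrow> 'a::{real_normed_field,banach}"
  assumes w: "weight w" and s: "(\<lambda>j. c j * norm (f j)) summable_on {1..}"
    and ev: "eventually (\<lambda>h. upper (X h) \<and> (\<forall>j\<ge>1. col_norm w (X h) j \<le> c j)) F"
    and lim: "\<And>n j. n \<ge> 1 \<Longrightarrow> n \<le> j \<Longrightarrow> ((\<lambda>h. X h n j) \<longlongrightarrow> 0) F"
  shows "((\<lambda>h. l1w_norm w (mat_app (X h) f)) \<longlongrightarrow> 0) F"
proof (cases "F = bot")
  case False
  let ?a = "\<lambda>k h. col_norm w (X h) (Suc k) * norm (f (Suc k))"
  let ?M = "\<lambda>k. c (Suc k) * norm (f (Suc k))"
  have "((\<lambda>h. \<Sum>k. ?a k h) \<longlongrightarrow> (\<Sum>k. 0)) F"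
  proof (intro tannerys_theorem[THEN conjunct2, THEN conjunct2] False)
    show "summable ?M"
      by (rule infsum_from_1_eq_suminf[OF s])
    show "((\<lambda>h. ?a k h) \<longlongrightarrow> 0) F" for k
      unfolding col_norm_def
      by (intro tendsto_mult_left_zero tendsto_null_sum tendsto_mult_right_zero tendsto_norm_zero lim) auto
    \<comment> \<open>Tannery's theorem asks for the majorant along a product filter; here it holds
      for every \<open>k\<close>.\<close>
    have "eventually (\<lambda>(k,h). True \<and> (upper (X h) \<and> (\<forall>j\<ge>1. col_norm w (X h) j \<le> c j))) (at_top \<times>\<^sub>F F)"
      using ev unfolding eventually_prod_filter by (intro exI[of _ "\<lambda>_. True"] exI) auto
    then show "eventually (\<lambda>(k,h). norm (?a k h) \<le> ?M k) (at_top \<times>\<^sub>F F)"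
      by eventually_elim (auto intro!: mult_right_mono simp: abs_mult col_norm_nonneg[OF w])
  qed
  then have lim0: "((\<lambda>h. \<Sum>k. ?a k h) \<longlongrightarrow> 0) F" by simp
  have "eventually (\<lambda>h. norm (l1w_norm w (mat_app (X h) f)) \<le> (\<Sum>k. ?a k h)) F"
    using ev
  proof eventually_elim
    case (elim h)
    then have cs: "col_summable w (X h) f"
      by (intro col_summable_comparison[OF w s]) auto
    have "l1w_norm w (mat_app (X h) f) \<le> (\<Sum>\<^sub>\<infinity>j\<in>{1..}. col_norm w (X h) j * norm (f j))"
      using elim by (intro mat_app_l1w[OF w _ cs]) auto
    also have "\<dots> = (\<Sum>k. ?a k h)"
      by (rule infsum_from_1_eq_suminf) (use cs in \<open>simp add: col_summable_def\<close>)
    finally show ?case using l1w_norm_nonneg[OF w, of "mat_app (X h) f"] by simp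
  qed
  then show ?thesis by (rule Lim_null_comparison[OF _ lim0])
qed auto

section \<open>The exponential of an upper triangular matrix\<close>

text \<open>Factors are added on the right, so column \<open>j\<close> of a power is built from
  columns \<open>1..j\<close> of the previous power.\<close>

primrec mat_pow :: "(nat \<Rightarrow> nat \<Rightarrow> real) \<Rightarrow> nat \<Rightarrow> nat \<Rightarrow> nat \<Rightarrow> real" where
  "mat_pow M 0 = id_mat"
| "mat_pow M (Suc k) = (\<lambda>n j. \<Sum>m=1..j. mat_pow M k n m * M m j)"

text \<open>The entrywise exponential series of \<open>z\<close> times the matrix. Its coefficients
  are real while \<open>z\<close> lies in any complete normed field, which treats real and complex
  time together.\<close>

definition tri_exp :: "(nat \<Rightarrow> nat \<Rightarrow> real) \<Rightarrow> 'a \<Rightarrow> nat \<Rightarrow> nat \<Rightarrow> 'a::{real_normed_field,banach}" where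
  "tri_exp M z n j = (\<Sum>k. of_real (mat_pow M k n j / fact k) * z ^ k)"

lemma upper_mat_pow: "upper (mat_pow M k)"
  by (induction k) (auto simp: id_mat_def upper_def intro!: sum.neutral)

lemma upper_tri_exp: "upper (tri_exp M z)"
  by (simp add: upper_def tri_exp_def upperD[OF upper_mat_pow])

text \<open>Columns up to \<open>N\<close> of the powers only see the leading block of size
  \<open>N\<close> of \<open>M\<close>, and the sum of the absolute values in that block bounds the
  growth caused by one more factor.\<close>

lemma mat_pow_bound:
  assumes "j \<le> N"
  shows "\<bar>mat_pow M k n j\<bar> \<le> (\<Sum>i=1..N. \<Sum>m=1..N. \<bar>M m i\<bar>) ^ k"
  using assms
proof (induction k arbitrary: j)
  case (Suc k)
  let ?C = "\<Sum>i=1..N. \<Sum>m=1..N. \<bar>M m i\<bar>"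
  have C0: "?C \<ge> 0" by (intro sum_nonneg) auto
  show ?case
  proof (cases "j = 0")
    case False
    have "(\<Sum>m=1..j. \<bar>M m j\<bar>) \<le> (\<Sum>m=1..N. \<bar>M m j\<bar>)"
      using Suc.prems by (intro sum_mono2) auto
    also have "\<dots> \<le> (\<Sum>i\<in>{1..N}. \<Sum>m=1..N. \<bar>M m i\<bar>)"
      using Suc.prems False by (intro member_le_sum) (auto intro: sum_nonneg)
    finally have col: "(\<Sum>m=1..j. \<bar>M m j\<bar>) \<le> ?C" .
    have "\<bar>mat_pow M (Suc k) n j\<bar> \<le> (\<Sum>m=1..j. \<bar>mat_pow M k n m\<bar> * \<bar>M m j\<bar>)"
      by (simp add: sum_abs[THEN order_trans] abs_mult)
    also have "\<dots> \<le> (\<Sum>m=1..j. ?C ^ k * \<bar>M m j\<bar>)"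
      using Suc by (intro sum_mono mult_right_mono) auto
    also have "\<dots> = ?C ^ k * (\<Sum>m=1..j. \<bar>M m j\<bar>)"
      by (simp add: sum_distrib_left)
    also have "\<dots> \<le> ?C ^ k * ?C"
      using C0 col by (intro mult_left_mono) auto
    finally show ?thesis by (simp add: mult.commute)
  qed (use C0 in \<open>simp add: mult_nonneg_nonneg\<close>)
qed (simp add: id_mat_def)

lemma summable_tri_exp:
  fixes z :: "'a::{real_normed_field,banach}"
  shows "summable (\<lambda>k. of_real (mat_pow M k n j / fact k) * z ^ k)"
proof (rule summable_comparison_test')
  let ?C = "\<Sum>i=1..j. \<Sum>m=1..j. \<bar>M m i\<bar>"
  show "summable (\<lambda>k. inverse (fact k) * (?C * norm z) ^ k)"
    by (rule summable_exp)
  fix k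
  have "\<bar>mat_pow M k n j\<bar> / fact k * norm z ^ k \<le> ?C ^ k / fact k * norm z ^ k"
    by (intro mult_right_mono divide_right_mono mat_pow_bound) auto
  then show "norm (of_real (mat_pow M k n j / fact k) * z ^ k) \<le> inverse (fact k) * (?C * norm z) ^ k"
    by (simp add: norm_mult norm_divide norm_power power_mult_distrib field_simps)
qed

lemma tri_exp_0: "tri_exp M 0 = id_mat"
proof (intro ext)
  show "tri_exp M 0 n j = (id_mat n j :: 'a)" for n j
    using powser_zero[of "\<lambda>k. of_real (mat_pow M k n j / fact k) :: 'a"]
    by (simp add: tri_exp_def id_mat_def)
qed

lemma tri_exp_of_real:
  "tri_exp M (of_real t :: 'a::{real_normed_field,banach}) n j = of_real (tri_exp M t n j)"
proof -
  have "of_real (tri_exp M t n j) = (\<Sum>k. of_real (of_real (mat_pow M k n j / fact k) * t ^ k) :: 'a)"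
    unfolding tri_exp_def by (rule suminf_of_real[OF summable_tri_exp])
  then show ?thesis
    by (simp add: tri_exp_def)
qed

text \<open>Termwise differentiation shifts the coefficients by one and so produces a factor
  \<open>M\<close> on the right: column \<open>j\<close> solves a linear equation that involves
  columns \<open>1..j\<close> only.\<close>

lemma tri_exp_deriv:
  fixes z :: "'a::{real_normed_field,banach}"
  shows "((\<lambda>z. tri_exp M z n j) has_field_derivative (\<Sum>m=1..j. tri_exp M z n m * of_real (M m j))) (at z)"
proof -
  have "((\<lambda>z. tri_exp M z n j) has_field_derivative
      (\<Sum>k. diffs (\<lambda>k. of_real (mat_pow M k n j / fact k)) k * z ^ k)) (at z)"
    unfolding tri_exp_def by (rule termdiffs_strong_converges_everywhere[OF summable_tri_exp])
  moreover have "diffs (\<lambda>k. of_real (mat_pow M k n j / fact k)) k * z ^ k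
      = (\<Sum>m=1..j. of_real (mat_pow M k n m / fact k) * z ^ k * of_real (M m j))" for k
  proof -
    have "diffs (\<lambda>k. of_real (mat_pow M k n j / fact k)) k = (of_real (mat_pow M (Suc k) n j / fact k) :: 'a)"
      unfolding diffs_def by (simp add: field_simps del: mat_pow.simps of_nat_Suc)
    also have "mat_pow M (Suc k) n j / fact k = (\<Sum>m=1..j. mat_pow M k n m / fact k * M m j)"
      by (simp add: sum_divide_distrib)
    finally show ?thesis
      by (simp add: sum_distrib_left sum_distrib_right mult_ac)
  qed
  moreover have "(\<Sum>k. \<Sum>m=1..j. of_real (mat_pow M k n m / fact k) * z ^ k * of_real (M m j))
      = (\<Sum>m=1..j. tri_exp M z n m * of_real (M m j))"
    unfolding tri_exp_def
    by (intro sums_unique[symmetric] sums_sum sums_mult2 summable_sums summable_tri_exp)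
  ultimately show ?thesis by simp
qed

section \<open>Uniqueness, addition law and positivity of the exponential\<close>

text \<open>Once the components below \<open>j\<close> vanish, only the scalar equation with
  coefficient \<open>M j j\<close> is left, and the integrating factor
  \<open>exp (- (M j j * z))\<close> makes its solution constant.\<close>

lemma tri_system_unique:
  fixes D :: "nat \<Rightarrow> 'a \<Rightarrow> 'a::{real_normed_field,banach}"
  assumes D: "\<And>j z. j \<ge> 1 \<Longrightarrow> (D j has_field_derivative (\<Sum>m=1..j. D m z * of_real (M m j))) (at z)"
    and D0: "\<And>j. j \<ge> 1 \<Longrightarrow> D j 0 = 0" and "j \<ge> 1"
  shows "D j z = 0"
  using \<open>j \<ge> 1\<close>
proof (induction j arbitrary: z rule: less_induct)
  case (less j)
  let ?m = "of_real (M j j) :: 'a"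
  have s: "(\<Sum>m=1..j. D m z * of_real (M m j)) = D j z * ?m" for z
  proof -
    have "(\<Sum>m=1..j. D m z * of_real (M m j)) = (\<Sum>m\<in>{j}. D m z * of_real (M m j))"
      using less.IH less.prems D0 by (intro sum.mono_neutral_right) auto
    then show ?thesis by simp
  qed
  have "\<exists>c. \<forall>z\<in>UNIV. D j z * exp (- (?m * z)) = c"
  proof (rule has_field_derivative_zero_constant[OF convex_UNIV])
    fix z
    show "((\<lambda>z. D j z * exp (- (?m * z))) has_field_derivative 0) (at z)"
      by (rule derivative_eq_intros D[OF less.prems] refl)+ (simp add: s[unfolded One_nat_def] algebra_simps)
  qed
  then have "D j z * exp (- (?m * z)) = D j 0 * exp (- (?m * 0))"
    by (metis UNIV_I)
  then show ?case using D0[OF less.prems] by simp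
qed

text \<open>As functions of \<open>z'\<close> both sides solve the same triangular system and agree
  at \<open>z' = 0\<close>; their difference vanishes by \<open>tri_system_unique\<close>.\<close>

lemma tri_exp_add:
  fixes z z' :: "'a::{real_normed_field,banach}"
  assumes "j \<ge> 1" "n \<ge> 1"
  shows "tri_exp M (z + z') n j = (\<Sum>m=1..j. tri_exp M z n m * tri_exp M z' m j)"
proof -
  define D where "D j z' = tri_exp M (z + z') n j - (\<Sum>m=1..j. tri_exp M z n m * tri_exp M z' m j)" for j z'
  have "D j z' = 0"
  proof (rule tri_system_unique[where M = M and D = D])
    fix j z' assume j: "j \<ge> (1::nat)"
    \<comment> \<open>Associativity of the product of the two exponentials with \<open>M\<close>;
      the inner range shrinks to \<open>1..k\<close> because later entries of column
      \<open>k\<close> are zero.\<close>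
    have swap: "(\<Sum>m=1..j. tri_exp M z n m * (\<Sum>k=1..j. tri_exp M z' m k * of_real (M k j)))
        = (\<Sum>k=1..j. (\<Sum>m=1..k. tri_exp M z n m * tri_exp M z' m k) * of_real (M k j))"
    proof -
      have "(\<Sum>m=1..j. tri_exp M z n m * (\<Sum>k=1..j. tri_exp M z' m k * of_real (M k j)))
          = (\<Sum>k=1..j. (\<Sum>m=1..j. tri_exp M z n m * tri_exp M z' m k) * of_real (M k j))"
        unfolding sum_distrib_left sum_distrib_right
        by (subst sum.swap) (simp add: mult.assoc)
      also have "\<dots> = (\<Sum>k=1..j. (\<Sum>m=1..k. tri_exp M z n m * tri_exp M z' m k) * of_real (M k j))"
        by (intro sum.cong arg_cong2[where f = "(*)"] refl sum.mono_neutral_right)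
          (auto simp: upperD[OF upper_tri_exp])
      finally show ?thesis .
    qed
    have shift: "((\<lambda>z'. tri_exp M (z + z') n j) has_field_derivative
        (\<Sum>m=1..j. tri_exp M (z + z') n m * of_real (M m j))) (at z')"
      using DERIV_shift[THEN iffD1, OF tri_exp_deriv[of M n j "z' + z"]] by (simp add: add.commute)
    show "(D j has_field_derivative (\<Sum>m=1..j. D m z' * of_real (M m j))) (at z')"
      unfolding D_def[abs_def] left_diff_distrib sum_subtractf swap[symmetric]
      by (intro DERIV_diff[OF shift] DERIV_sum DERIV_cmult tri_exp_deriv)
  next
    fix j :: nat assume "j \<ge> 1"
    have "(\<Sum>m=1..j. tri_exp M z n m * id_mat m j) = (\<Sum>m\<in>{j}. tri_exp M z n m * id_mat m j)"
      using \<open>j \<ge> 1\<close> by (intro sum.mono_neutral_right) (auto simp: id_mat_def)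
    then show "D j 0 = 0" by (simp add: D_def tri_exp_0 id_mat_def)
  qed (rule assms)
  then show ?thesis by (simp add: D_def)
qed

text \<open>The diagonal may have any sign: multiplying by \<open>exp (- (M j j * t))\<close>
  removes it, and what remains of the derivative combines earlier columns with nonnegative
  coefficients.\<close>

lemma tri_exp_nonneg:
  assumes M: "\<And>m j. 1 \<le> m \<Longrightarrow> m < j \<Longrightarrow> M m j \<ge> 0" and "j \<ge> 1" and "t \<ge> (0::real)"
  shows "tri_exp M t n j \<ge> 0"
  using assms(2,3)
proof (induction j arbitrary: t rule: less_induct)
  case (less j)
  let ?g = "\<lambda>t. tri_exp M t n j * exp (- (M j j * t))"
  let ?r = "\<lambda>t. \<Sum>m\<in>{1..<j}. tri_exp M t n m * M m j"
  have s: "(\<Sum>m=1..j. tri_exp M t n m * M m j) = ?r t + tri_exp M t n j * M j j" for t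
    using less.prems by (simp add: sum.last_plus add.commute)
  have d: "(?g has_field_derivative ?r t * exp (- (M j j * t))) (at t)" for t
    by (rule derivative_eq_intros tri_exp_deriv refl)+ (simp only: of_real_eq_id id_apply s, simp add: algebra_simps)
  have "?g 0 \<le> ?g t"
  proof (rule DERIV_nonneg_imp_nondecreasing[OF less.prems(2)])
    fix u :: real assume "0 \<le> u"
    then have "0 \<le> ?r u"
      using less.IH by (intro sum_nonneg mult_nonneg_nonneg M) auto
    then show "\<exists>y. (?g has_real_derivative y) (at u) \<and> 0 \<le> y"
      using d[of u] mult_nonneg_nonneg[of "?r u" "exp (- (M j j * u))"] by force
  qed
  moreover have "?g 0 \<ge> 0" by (simp add: tri_exp_0 id_mat_def)
  ultimately have "?g t \<ge> 0" by linarith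
  then show ?case by (simp add: zero_le_mult_iff)
qed

text \<open>A fixed functional \<open>c\<close> applied to all columns gives scalar functions that
  satisfy a closed triangular system. Column norms are estimated through such functionals.\<close>

lemma tri_functional_deriv:
  fixes z :: "'a::{real_normed_field,banach}"
  shows "((\<lambda>z. \<Sum>n=1..j. c n * tri_exp M z n j) has_field_derivative
    (\<Sum>m=1..j. (\<Sum>n=1..m. c n * tri_exp M z n m) * of_real (M m j))) (at z)"
proof -
  have "(\<Sum>m=1..j. (\<Sum>n=1..m. c n * tri_exp M z n m) * of_real (M m j))
      = (\<Sum>m=1..j. (\<Sum>n=1..j. c n * tri_exp M z n m) * of_real (M m j))"
    by (intro sum.cong arg_cong2[where f = "(*)"] refl sum.mono_neutral_left)
      (auto simp: upperD[OF upper_tri_exp])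
  also have "\<dots> = (\<Sum>n=1..j. c n * (\<Sum>m=1..j. tri_exp M z n m * of_real (M m j)))"
    unfolding sum_distrib_left sum_distrib_right by (subst sum.swap) (simp add: mult.assoc)
  finally show ?thesis
    by (simp only:) (intro DERIV_sum DERIV_cmult tri_exp_deriv)
qed

section \<open>The fragmentation matrix\<close>

definition frag_mat :: "(nat \<Rightarrow> real) \<Rightarrow> (nat \<Rightarrow> nat \<Rightarrow> real) \<Rightarrow> nat \<Rightarrow> nat \<Rightarrow> real" where
  "frag_mat a b n j = (if n = j then - a j else if n < j then a j * b n j else 0)"

lemma upper_frag_mat: "upper (frag_mat a b)"
  by (simp add: upper_def frag_mat_def)

text \<open>The multiplier that turns an entry into its modulus, and hence a column norm into the
  value of a linear functional.\<close>

lemma cnj_sgn_mult: "cnj (sgn z) * z = of_real (norm z)"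
proof (cases "z = 0")
  case False
  then show ?thesis
    using complex_norm_square[of z]
    by (simp add: sgn_eq mult.commute power2_eq_square field_simps)
qed simp

lemma col_norm_of_real:
  "col_norm w (\<lambda>n j. of_real (X n j) :: 'a::real_normed_field) = col_norm w X"
  by (simp add: col_norm_def fun_eq_iff)

lemma upper_of_real: "upper X \<Longrightarrow> upper (\<lambda>n j. of_real (X n j) :: 'a::real_normed_field)"
  by (simp add: upper_def)

lemma mat_app_cong:
  assumes "\<And>n j. n \<ge> 1 \<Longrightarrow> j \<ge> 1 \<Longrightarrow> X n j * f j = Y n j * g j"
  shows "mat_app X f = mat_app Y g"
  by (auto simp: mat_app_def fun_eq_iff intro!: infsum_cong assms)

text \<open>After multiplication by \<open>a j\<close>, \<open>col_bound\<close> says that column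
  \<open>j\<close> of \<open>B\<close> has norm at most \<open>\<kappa>\<close> times that of column
  \<open>j\<close> of \<open>A\<close>: the gain is a fraction \<open>\<kappa> < 1\<close> of the
  loss.\<close>

locale fragmentation =
  fixes a :: "nat \<Rightarrow> real" and b :: "nat \<Rightarrow> nat \<Rightarrow> real" and w :: "nat \<Rightarrow> real" and \<kappa> :: real
  assumes weight: "weight w"
    and a_nonneg: "\<And>n. n \<ge> 1 \<Longrightarrow> a n \<ge> 0"
    and b_nonneg: "\<And>n j. n \<ge> 1 \<Longrightarrow> j \<ge> 1 \<Longrightarrow> b n j \<ge> 0"
    and kappa: "0 \<le> \<kappa>" "\<kappa> < 1"
    and col_bound: "\<And>j. j \<ge> 1 \<Longrightarrow> (\<Sum>n\<in>{1..<j}. w n * b n j) \<le> \<kappa> * w j"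
begin

abbreviation "E \<equiv> tri_exp (frag_mat a b)"

lemma w_pos: "n \<ge> 1 \<Longrightarrow> 0 < w n"
  using weight by (rule weightD)

text \<open>Separates gain from loss: \<open>col_bound\<close> controls the first term, and an
  integrating factor absorbs the second.\<close>

lemma sum_frag_mat:
  fixes \<phi> :: "nat \<Rightarrow> 'b::real_normed_field"
  assumes "j \<ge> 1"
  shows "(\<Sum>m=1..j. \<phi> m * of_real (frag_mat a b m j))
    = of_real (a j) * (\<Sum>m\<in>{1..<j}. \<phi> m * of_real (b m j)) - of_real (a j) * \<phi> j"
proof -
  have "{1..j} = insert j {1..<j}" using assms by auto
  then have "(\<Sum>m=1..j. \<phi> m * of_real (frag_mat a b m j))
      = \<phi> j * of_real (frag_mat a b j j) + (\<Sum>m\<in>{1..<j}. \<phi> m * of_real (frag_mat a b m j))"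
    by simp
  also have "(\<Sum>m\<in>{1..<j}. \<phi> m * of_real (frag_mat a b m j))
      = (\<Sum>m\<in>{1..<j}. of_real (a j) * (\<phi> m * of_real (b m j)))"
    by (intro sum.cong) (auto simp: frag_mat_def)
  finally show ?thesis
    by (simp add: frag_mat_def sum_distrib_left)
qed

lemma col_norm_frag_mat:
  assumes "j \<ge> 1"
  shows "col_norm w (frag_mat a b) j \<le> (1 + \<kappa>) * (a j * w j)"
proof -
  have "{1..j} = insert j {1..<j}" using assms by auto
  then have "col_norm w (frag_mat a b) j
      = w j * \<bar>frag_mat a b j j\<bar> + (\<Sum>m\<in>{1..<j}. w m * \<bar>frag_mat a b m j\<bar>)"
    by (simp add: col_norm_def)
  also have "(\<Sum>m\<in>{1..<j}. w m * \<bar>frag_mat a b m j\<bar>) = a j * (\<Sum>m\<in>{1..<j}. w m * b m j)"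
    unfolding sum_distrib_left
    by (intro sum.cong) (use assms in \<open>auto simp: frag_mat_def a_nonneg b_nonneg\<close>)
  also have "\<dots> \<le> a j * (\<kappa> * w j)"
    using assms by (intro mult_left_mono col_bound a_nonneg)
  finally show ?thesis
    using a_nonneg[OF assms] by (simp add: frag_mat_def[of a b j j] algebra_simps)
qed

section \<open>Contraction estimates for the columns of the exponential\<close>

text \<open>Along a ray of direction \<open>e\<close> the diagonal entry contributes the decay rate \<open>a j * Re e\<close> and the
  entries above it a gain of at most \<open>\<kappa> * a j\<close>; so the bound \<open>w j\<close> propagates as long as
  \<open>\<kappa> \<le> Re e\<close>. The convex-combination form of the bound is what identifies the domain of the
  generator.\<close>

lemma ray_functional_bound:
  fixes \<sigma> :: "nat \<Rightarrow> complex"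
  assumes e: "\<kappa> \<le> Re e" "0 < Re e" "norm e = 1" and \<sigma>: "\<And>n. norm (\<sigma> n) \<le> 1"
    and "j \<ge> 1" "t \<ge> 0"
  shows "norm (\<Sum>n=1..j. of_real (w n) * \<sigma> n * E (of_real t * e) n j)
    \<le> w j * (exp (- (a j * Re e * t)) + \<kappa> / Re e * (1 - exp (- (a j * Re e * t))))"
  using assms(5,6)
proof (induction j arbitrary: t rule: less_induct)
  case (less j)
  define c where "c = Re e"
  define \<phi> where "\<phi> m z = (\<Sum>n=1..m. of_real (w n) * \<sigma> n * E z n m)" for m and z :: complex
  have c: "\<kappa> \<le> c" "0 < c" using e by (auto simp: c_def)
  \<comment> \<open>The factor of \<open>w m\<close> in the induction hypothesis is a convex
    combination of 1 and \<open>\<kappa> / c\<close>, hence at most 1.\<close>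
  have IH: "norm (\<phi> m (of_real s * e)) \<le> w m" if "m \<in> {1..<j}" "s \<ge> 0" for m s
  proof -
    let ?x = "exp (- (a m * c * s))"
    have x: "?x \<le> 1" using that c a_nonneg[of m] by simp
    have "\<kappa> / c * (1 - ?x) \<le> 1 * (1 - ?x)"
      using x c by (intro mult_right_mono) auto
    then have "w m * (?x + \<kappa> / c * (1 - ?x)) \<le> w m * 1"
      using that w_pos[of m] by (intro mult_left_mono) auto
    then show ?thesis
      using less.IH[of m s] that by (simp add: \<phi>_def c_def)
  qed
  \<comment> \<open>The integrating factor \<open>exp (of_real (a j) * z)\<close> cancels the
    diagonal term, so that \<open>g'\<close> contains only columns below \<open>j\<close>.\<close>
  define g where "g z = exp (of_real (a j) * z) * \<phi> j z" for z
  define g' where "g' z = exp (of_real (a j) * z) * (of_real (a j) * (\<Sum>m\<in>{1..<j}. \<phi> m z * of_real (b m j)))" for z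
  have g: "(g has_field_derivative g' z) (at z)" for z
  proof -
    have "(\<phi> j has_field_derivative (\<Sum>m=1..j. \<phi> m z * of_real (frag_mat a b m j))) (at z)"
      unfolding \<phi>_def[abs_def] by (rule tri_functional_deriv)
    note d = this[unfolded sum_frag_mat[OF less.prems(1)]]
    show ?thesis
      unfolding g_def[abs_def] g'_def
      by (rule derivative_eq_intros d refl)+ (simp add: algebra_simps)
  qed
  have gv: "((\<lambda>s. g (of_real s * e)) has_vector_derivative e * g' (of_real s * e)) (at s)" for s
  proof -
    have "((\<lambda>s. of_real s * e) has_vector_derivative e) (at s)"
      using has_vector_derivative_mult_left[OF has_vector_derivative_of_real[OF DERIV_ident]] by force
    from field_vector_diff_chain_at[OF this g] show ?thesis
      by (simp add: o_def)
  qed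
  \<comment> \<open>A primitive of the bound on the speed of \<open>g\<close> along the ray. Writing
    it with the denominator \<open>c\<close> avoids dividing by \<open>a j\<close>, which may be
    0.\<close>
  define G where "G s = \<kappa> * w j / c * exp (a j * c * s)" for s
  have Gv: "(G has_vector_derivative \<kappa> * w j * a j * exp (a j * c * s)) (at s)" for s
    unfolding G_def[abs_def] has_real_derivative_iff_has_vector_derivative[symmetric]
    using c by (auto intro!: derivative_eq_intros)
  have bnd: "norm (e * g' (of_real s * e)) \<le> \<kappa> * w j * a j * exp (a j * c * s)" if "s \<ge> 0" for s
  proof -
    have "norm (\<Sum>m\<in>{1..<j}. \<phi> m (of_real s * e) * of_real (b m j)) \<le> (\<Sum>m\<in>{1..<j}. w m * b m j)"
    proof (rule sum_norm_le)
      fix m assume m: "m \<in> {1..<j}"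
      then show "norm (\<phi> m (of_real s * e) * of_real (b m j)) \<le> w m * b m j"
        using IH[OF m that] b_nonneg[of m j] by (simp add: norm_mult mult_right_mono)
    qed
    also have "\<dots> \<le> \<kappa> * w j" by (rule col_bound[OF less.prems(1)])
    finally have "exp (a j * c * s) * (a j * norm (\<Sum>m\<in>{1..<j}. \<phi> m (of_real s * e) * of_real (b m j)))
        \<le> exp (a j * c * s) * (a j * (\<kappa> * w j))"
      using a_nonneg[OF less.prems(1)] by (intro mult_left_mono) auto
    moreover have "norm (exp (of_real (a j) * (of_real s * e))) = exp (a j * c * s)"
      by (simp add: c_def mult_ac)
    ultimately show ?thesis
      using a_nonneg[OF less.prems(1)] by (simp add: g'_def norm_mult e(3) c_def[symmetric] mult_ac)
  qed
  have "norm (g (of_real t * e) - g (of_real 0 * e)) \<le> G t - G 0"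
  proof (cases "t = 0")
    case False
    show ?thesis
    proof (rule differentiable_bound_general[where f = "\<lambda>s. g (of_real s * e)" and \<phi> = G])
      show "0 < t" using False less.prems by simp
      show "continuous_on {0..t} (\<lambda>s. g (of_real s * e))"
        using gv by (meson continuous_at_imp_continuous_on has_vector_derivative_continuous)
      show "continuous_on {0..t} G"
        using Gv by (meson continuous_at_imp_continuous_on has_vector_derivative_continuous)
    qed (auto intro: gv Gv bnd)
  qed simp
  moreover have "norm (g 0) \<le> w j"
  proof -
    have "\<phi> j 0 = (\<Sum>n\<in>{j}. of_real (w n) * \<sigma> n * id_mat n j)"
      unfolding \<phi>_def tri_exp_0 using less.prems
      by (intro sum.mono_neutral_right) (auto simp: id_mat_def)
    then have "g 0 = of_real (w j) * \<sigma> j" by (simp add: g_def id_mat_def)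
    then show ?thesis
      using mult_left_mono[OF \<sigma>[of j], of "w j"] w_pos[OF less.prems(1)] by (simp add: norm_mult)
  qed
  ultimately have "norm (g (of_real t * e)) \<le> w j + (G t - G 0)"
    using norm_triangle_ineq2[of "g (of_real t * e)" "g 0"] by simp
  moreover have "norm (g (of_real t * e)) = exp (a j * c * t) * norm (\<phi> j (of_real t * e))"
    by (simp add: g_def norm_mult c_def mult_ac)
  ultimately have "exp (- (a j * c * t)) * (exp (a j * c * t) * norm (\<phi> j (of_real t * e)))
      \<le> exp (- (a j * c * t)) * (w j + (G t - G 0))"
    by (intro mult_left_mono) auto
  moreover have "exp (- (a j * c * t)) * (w j + (G t - G 0))
      = w j * (exp (- (a j * c * t)) + \<kappa> / c * (1 - exp (- (a j * c * t))))"
  proof -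
    have "exp (- (a j * c * t)) * exp (a j * c * t) = 1" by (simp add: exp_minus)
    then have "exp (- (a j * c * t)) * G t = \<kappa> * w j / c" by (simp add: G_def)
    then show ?thesis by (simp add: G_def distrib_left right_diff_distrib) (simp add: mult_ac)
  qed
  moreover have "exp (- (a j * c * t)) * (exp (a j * c * t) * y) = y" for y
    by (simp add: exp_minus)
  ultimately show ?case
    by (simp only: \<phi>_def c_def)
qed

text \<open>The functional bound is uniform in \<open>\<sigma>\<close>, so \<open>\<sigma>\<close>
  may be chosen for the given \<open>t\<close> and \<open>j\<close> as the conjugate signs of the
  column.\<close>

lemma col_norm_ray:
  assumes e: "\<kappa> \<le> Re e" "0 < Re e" "norm e = 1" and j: "j \<ge> 1" and t: "t \<ge> 0"
  shows "col_norm w (E (of_real t * e)) j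
    \<le> w j * (exp (- (a j * Re e * t)) + \<kappa> / Re e * (1 - exp (- (a j * Re e * t))))"
proof -
  let ?\<sigma> = "\<lambda>n. cnj (sgn (E (of_real t * e) n j))"
  have "(\<Sum>n=1..j. of_real (w n) * ?\<sigma> n * E (of_real t * e) n j)
      = of_real (col_norm w (E (of_real t * e)) j)"
    by (simp add: col_norm_def mult.assoc cnj_sgn_mult)
  moreover have "norm (\<Sum>n=1..j. of_real (w n) * ?\<sigma> n * E (of_real t * e) n j)
    \<le> w j * (exp (- (a j * Re e * t)) + \<kappa> / Re e * (1 - exp (- (a j * Re e * t))))"
    by (rule ray_functional_bound[OF e _ j t]) (simp add: norm_sgn)
  ultimately show ?thesis
    using col_norm_nonneg[OF weight] by simp
qed

lemma col_norm_real:
  assumes j: "j \<ge> 1" and t: "t \<ge> (0::real)"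
  shows "col_norm w (E t) j \<le> w j * (exp (- (a j * t)) + \<kappa> * (1 - exp (- (a j * t))))"
proof -
  have "col_norm w (E t) j = col_norm w (E (of_real t * (1::complex))) j"
    by (simp add: col_norm_def tri_exp_of_real)
  then show ?thesis
    using col_norm_ray[of 1 j t] j t kappa by simp
qed

lemma contraction_factor:
  assumes "j \<ge> 1" "t \<ge> 0"
  shows "w j * (exp (- (a j * t)) + \<kappa> * (1 - exp (- (a j * t)))) \<le> w j"
proof -
  have "\<kappa> * (1 - exp (- (a j * t))) \<le> 1 * (1 - exp (- (a j * t)))"
    using kappa a_nonneg[OF assms(1)] assms(2) by (intro mult_right_mono) auto
  then show ?thesis
    using w_pos[OF assms(1)] by simp
qed

lemma col_norm_real_le:
  "j \<ge> 1 \<Longrightarrow> t \<ge> (0::real) \<Longrightarrow> col_norm w (E t) j \<le> w j"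
  by (rule order_trans[OF col_norm_real contraction_factor])

text \<open>Such a \<open>z\<close> lies on a ray whose direction \<open>e\<close> satisfies
  \<open>\<kappa> < Re e\<close>, and there the ray bound is a convex combination of
  \<open>w j\<close> and something smaller or equal.\<close>

lemma col_norm_cone:
  assumes z: "\<kappa> * norm z < Re z" and j: "j \<ge> 1"
  shows "col_norm w (E z) j \<le> w j"
proof -
  have "0 \<le> \<kappa> * norm z" using kappa by simp
  then have "Re z > 0" using z by linarith
  then have z0: "norm z > 0" by auto
  define e where "e = z / of_real (norm z)"
  have Re_e: "Re e = Re z / norm z" by (simp add: e_def)
  have e: "\<kappa> \<le> Re e" "0 < Re e" "norm e = 1"
    using z0 z \<open>Re z > 0\<close> by (auto simp: Re_e field_simps) (simp add: e_def norm_divide)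
  have "z = of_real (norm z) * e" using z0 by (simp add: e_def)
  then have "col_norm w (E z) j
      \<le> w j * (exp (- (a j * Re e * norm z)) + \<kappa> / Re e * (1 - exp (- (a j * Re e * norm z))))"
    using col_norm_ray[OF e j, of "norm z"] by simp
  also have "\<dots> \<le> w j * (exp (- (a j * Re e * norm z)) + 1 * (1 - exp (- (a j * Re e * norm z))))"
    using w_pos[OF j] e a_nonneg[OF j] by (intro mult_left_mono add_left_mono mult_right_mono) auto
  finally show ?thesis by simp
qed

text \<open>The derivative of the exponential is \<open>E t\<close> times the matrix, and
  \<open>E t\<close> contracts columns, so column \<open>j\<close> moves at most at the speed
  \<open>col_norm w (frag_mat a b) j\<close>. Being linear in \<open>h\<close>, the bound yields a
  majorant for difference quotients.\<close>

lemma col_norm_increment: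
  assumes j: "j \<ge> 1" and h: "h \<ge> (0::real)"
  shows "col_norm w (\<lambda>n j. E h n j - id_mat n j) j \<le> h * ((1 + \<kappa>) * (a j * w j))"
proof -
  \<comment> \<open>The signs are frozen at the final time \<open>h\<close>, which makes
    \<open>\<phi> j h - \<phi> j 0\<close> equal to the column norm in question.\<close>
  define \<sigma> where "\<sigma> n = sgn (E h n j - id_mat n j)" for n
  define \<phi> where "\<phi> m t = (\<Sum>n=1..m. w n * \<sigma> n * E t n m)" for m and t :: real
  have \<phi>: "\<bar>\<phi> m t\<bar> \<le> w m" if "m \<ge> 1" "t \<ge> 0" for m t
  proof -
    have "\<bar>\<phi> m t\<bar> \<le> (\<Sum>n=1..m. \<bar>w n * \<sigma> n * E t n m\<bar>)"
      unfolding \<phi>_def by (rule sum_abs)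
    also have "\<dots> \<le> col_norm w (E t) m"
      unfolding col_norm_def
    proof (intro sum_mono)
      fix n assume "n \<in> {1..m}"
      then have "\<bar>\<sigma> n\<bar> \<le> 1" "0 < w n" using w_pos[of n] by (auto simp: \<sigma>_def sgn_if)
      then show "\<bar>w n * \<sigma> n * E t n m\<bar> \<le> w n * norm (E t n m)"
        using mult_right_mono[of "\<bar>\<sigma> n\<bar>" 1 "w n * \<bar>E t n m\<bar>"] by (simp add: abs_mult mult_ac)
    qed
    also have "\<dots> \<le> w m" by (rule col_norm_real_le[OF that])
    finally show ?thesis .
  qed
  let ?B = "(1 + \<kappa>) * (a j * w j)"
  have "norm (\<phi> j h - \<phi> j 0) \<le> ?B * norm (h - 0)"
  proof (rule field_differentiable_bound[of "{0..h}"])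
    fix t assume t: "t \<in> {0..h}"
    show "(\<phi> j has_real_derivative (\<Sum>m=1..j. \<phi> m t * of_real (frag_mat a b m j))) (at t within {0..h})"
      unfolding \<phi>_def[abs_def]
      by (rule has_field_derivative_at_within[OF tri_functional_deriv])
    have "norm (\<Sum>m=1..j. \<phi> m t * of_real (frag_mat a b m j)) \<le> col_norm w (frag_mat a b) j"
      unfolding col_norm_def
      by (rule sum_norm_le) (use t \<phi> in \<open>auto simp: abs_mult intro!: mult_right_mono\<close>)
    then show "norm (\<Sum>m=1..j. \<phi> m t * of_real (frag_mat a b m j)) \<le> ?B"
      using col_norm_frag_mat[OF j] by simp
  qed (use h in auto)
  moreover have "\<phi> j h - \<phi> j 0 = col_norm w (\<lambda>n j. E h n j - id_mat n j) j"
  proof -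
    have "\<phi> j h - \<phi> j 0 = (\<Sum>n=1..j. w n * ((E h n j - id_mat n j) * \<sigma> n))"
      by (simp add: \<phi>_def tri_exp_0 sum_subtractf[symmetric] algebra_simps)
    then show ?thesis
      by (simp add: \<sigma>_def col_norm_def abs_sgn[symmetric])
  qed
  ultimately show ?thesis
    using h col_norm_nonneg[OF weight, of "\<lambda>n j. E h n j - id_mat n j" j] by (simp add: mult.commute)
qed

section \<open>The semigroup on the real half-axis\<close>

text \<open>The real exponential matrix is embedded into the scalars, so one construction serves the
  real and the complex space.\<close>

definition real_semigroup :: "real \<Rightarrow> (nat \<Rightarrow> 'a) \<Rightarrow> nat \<Rightarrow> 'a::{real_normed_field,banach}" where
  "real_semigroup t = mat_app (\<lambda>n j. of_real (E t n j))"

text \<open>The factor 1 is kept to match the pattern \<open>C * w j\<close> of the general lemmas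
  on bounded matrices.\<close>

lemma col_norm_semigroup:
  assumes "j \<ge> 1" "t \<ge> (0::real)"
  shows "col_norm w (\<lambda>n j. of_real (E t n j) :: 'a::{real_normed_field,banach}) j \<le> 1 * w j"
  using col_norm_real_le[OF assms] by (simp add: col_norm_of_real)

lemmas upper_semigroup = upper_of_real[OF upper_tri_exp]

lemma real_semigroup_l1w:
  assumes "t \<ge> 0" "f \<in> l1w w"
  shows "real_semigroup t f \<in> l1w w"
  unfolding real_semigroup_def
  by (rule mat_app_l1w(1)[OF weight upper_semigroup col_summable_bounded[OF weight assms(2) col_norm_semigroup]])
    (use assms in auto)

text \<open>Stated along an arbitrary filter so as to cover both \<open>at_right 0\<close> and
  approach to 0 within a complex sector. The majorant \<open>2 * w j\<close> is one
  \<open>w j\<close> for the exponential and one for the identity.\<close>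

lemma exp_strongly_continuous:
  fixes \<zeta> :: "'i \<Rightarrow> 'b::{real_normed_field,banach}"
  assumes \<zeta>: "(\<zeta> \<longlongrightarrow> 0) F"
    and ev: "eventually (\<lambda>i. \<forall>j\<ge>1. col_norm w (E (\<zeta> i)) j \<le> w j) F" and f: "f \<in> l1w w"
  shows "((\<lambda>i. l1w_norm w (\<lambda>n. mat_app (E (\<zeta> i)) f n - f n)) \<longlongrightarrow> 0) F"
proof -
  let ?X = "\<lambda>i n j. E (\<zeta> i) n j - id_mat n j"
  have "((\<lambda>i. l1w_norm w (mat_app (?X i) f)) \<longlongrightarrow> 0) F"
  proof (rule mat_app_tendsto_0[OF weight, where c = "\<lambda>j. 2 * w j"])
    show "(\<lambda>j. 2 * w j * norm (f j)) summable_on {1..}"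
      using summable_on_cmult_right[OF l1w_summable[OF f], of 2] by (simp add: mult.assoc)
    show "eventually (\<lambda>i. upper (?X i) \<and> (\<forall>j\<ge>1. col_norm w (?X i) j \<le> 2 * w j)) F"
      using ev
    proof eventually_elim
      case (elim i)
      have "col_norm w (?X i) j \<le> 2 * w j" if "j \<ge> 1" for j
        using col_norm_lincomb[OF weight, of 1 "E (\<zeta> i)" "-1" id_mat j] elim[rule_format, OF that]
          col_norm_id_mat[OF that, of w, where 'a = 'b] by simp
      then show ?case
        using upper_lincomb[OF upper_tri_exp[of "frag_mat a b" "\<zeta> i"] upper_id_mat, of 1 "-1"] by simp
    qed
    fix n j
    have "isCont (\<lambda>z. E z n j) (0 :: 'b)"
      by (rule DERIV_isCont[OF tri_exp_deriv])
    then have "((\<lambda>i. E (\<zeta> i) n j) \<longlongrightarrow> E 0 n j) F"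
      by (rule isCont_tendsto_compose[OF _ \<zeta>])
    then show "((\<lambda>i. ?X i n j) \<longlongrightarrow> 0) F"
      by (simp add: tri_exp_0 LIM_zero)
  qed
  moreover have "eventually (\<lambda>i. l1w_norm w (mat_app (?X i) f) = l1w_norm w (\<lambda>n. mat_app (E (\<zeta> i)) f n - f n)) F"
    using ev
  proof eventually_elim
    case (elim i)
    have "mat_app (?X i) f = (\<lambda>n. mat_app (E (\<zeta> i)) f n - mat_app id_mat f n)"
      using elim col_norm_id_mat[of _ w, where 'a = 'b]
      by (intro mat_app_diff[OF weight] upper_tri_exp upper_id_mat col_summable_bounded[OF weight f, of _ 1]) auto
    then show ?case by (simp add: mat_app_id_mat[of f, OF l1w_zero[OF f]])
  qed
  ultimately show ?thesis by (simp cong: tendsto_cong)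
qed

lemma exp_semigroup_law:
  fixes z z' :: "'b::{real_normed_field,banach}"
  assumes "\<And>j. j \<ge> 1 \<Longrightarrow> col_norm w (E z) j \<le> w j" "\<And>j. j \<ge> 1 \<Longrightarrow> col_norm w (E z') j \<le> w j" "f \<in> l1w w"
  shows "mat_app (E (z + z')) f = mat_app (E z) (mat_app (E z') f)"
proof -
  have "mat_app (E z) (mat_app (E z') f) = mat_app (\<lambda>n j. \<Sum>m=1..j. E z n m * E z' m j) f"
    by (rule mat_app_compose[OF weight upper_tri_exp _ upper_tri_exp, of _ _ 1 _ _ 1]) (use assms in auto)
  also have "\<dots> = mat_app (E (z + z')) f"
    by (rule mat_app_cong) (simp add: tri_exp_add)
  finally show ?thesis by simp
qed

lemma real_semigroup_eq: "real_semigroup t f = mat_app (E (of_real t)) f"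
  unfolding real_semigroup_def by (rule mat_app_cong) (simp add: tri_exp_of_real)

lemma col_norm_exp_of_real:
  "j \<ge> 1 \<Longrightarrow> t \<ge> 0 \<Longrightarrow> col_norm w (E (of_real t :: 'b::{real_normed_field,banach})) j \<le> w j"
  using col_norm_real_le[of j t] by (simp add: col_norm_def tri_exp_of_real)

lemma C0_real_semigroup:
  "C0_semigroup w (real_semigroup :: real \<Rightarrow> (nat \<Rightarrow> 'b::{real_normed_field,banach}) \<Rightarrow> nat \<Rightarrow> 'b)"
  unfolding C0_semigroup_def
proof (intro conjI allI ballI impI)
  fix t :: real assume "t \<ge> 0"
  then show "bounded_op w (real_semigroup t :: (nat \<Rightarrow> 'b) \<Rightarrow> nat \<Rightarrow> 'b)"
    unfolding real_semigroup_def by (intro bounded_op_mat_app[OF weight upper_semigroup, where C = 1] col_norm_semigroup)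
next
  fix f :: "nat \<Rightarrow> 'b" assume f: "f \<in> l1w w"
  show "real_semigroup 0 f = f"
    using mat_app_id_mat[of f, OF l1w_zero[OF f]] by (simp add: real_semigroup_eq tri_exp_0)
  show "((\<lambda>t. l1w_norm w (\<lambda>n. real_semigroup t f n - f n)) \<longlongrightarrow> 0) (at_right 0)"
    unfolding real_semigroup_eq
  proof (rule exp_strongly_continuous[OF _ _ f])
    show "((\<lambda>t. of_real t :: 'b) \<longlongrightarrow> 0) (at_right 0)"
      using tendsto_of_real[OF tendsto_ident_at, of 0 "{0<..}"] by simp
    show "\<forall>\<^sub>F t in at_right 0. \<forall>j\<ge>1. col_norm w (E (of_real t :: 'b)) j \<le> w j"
      using eventually_at_right_less[of 0] by eventually_elim (auto intro: col_norm_exp_of_real)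
  qed
  fix s t :: real assume "s \<ge> 0" "t \<ge> 0"
  then show "real_semigroup (s + t) f = real_semigroup s (real_semigroup t f)"
    unfolding real_semigroup_eq of_real_add by (intro exp_semigroup_law f col_norm_exp_of_real)
qed

text \<open>Positivity comes from the nonnegative entries, the norm bound from the contraction of
  columns. For scalars in \<open>'b\<close> each row is exhibited as the image under
  \<open>of_real\<close> of a series of nonnegative reals.\<close>

lemma substochastic_real_semigroup:
  "substochastic w (real_semigroup :: real \<Rightarrow> (nat \<Rightarrow> 'b::{real_normed_field,banach}) \<Rightarrow> nat \<Rightarrow> 'b)"
  unfolding substochastic_def
proof (intro allI impI ballI)
  fix t :: real and f :: "nat \<Rightarrow> 'b"
  assume t: "0 \<le> t" and "f \<in> l1w_cone w"
  then have f: "f \<in> l1w w" and f0: "\<And>n. n \<ge> 1 \<Longrightarrow> f n \<in> \<real>\<^sub>\<ge>\<^sub>0"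
    by (auto simp: l1w_cone_def)
  have "real_semigroup t f n \<in> \<real>\<^sub>\<ge>\<^sub>0" if n: "n \<ge> 1" for n
  proof -
    define x where "x j = E t n j * norm (f j)" for j
    have E0: "E t n j \<ge> 0" if "j \<ge> 1" for j
      using that t by (intro tri_exp_nonneg) (auto simp: frag_mat_def a_nonneg b_nonneg)
    then have x0: "x j \<ge> 0" if "j \<ge> 1" for j
      using that by (simp add: x_def)
    have fn: "f j = of_real (norm (f j))" if "j \<ge> 1" for j
      using f0[OF that] by (auto elim: nonneg_Reals_cases)
    have sm: "(\<lambda>j. norm (of_real (E t n j) * f j)) summable_on {1..}"
      by (rule mat_row_abs_summable[OF weight upper_semigroup col_summable_bounded[OF weight f col_norm_semigroup[OF _ t]] n])
    have "x summable_on {1..}"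
      by (rule summable_on_cong[THEN iffD1, OF _ sm]) (simp add: x_def norm_mult E0)
    then have "((\<lambda>j. of_real (x j) :: 'b) has_sum of_real (infsum x {1..})) {1..}"
      by (intro has_sum_of_real has_sum_infsum)
    then have "((\<lambda>j. of_real (E t n j) * f j) has_sum of_real (infsum x {1..})) {1..}"
      by (rule has_sum_cong[THEN iffD1, rotated]) (simp add: x_def fn[symmetric])
    then have "real_semigroup t f n = of_real (infsum x {1..})"
      using n unfolding real_semigroup_def mat_app_def by (simp only: infsumI) simp
    moreover have "infsum x {1..} \<ge> 0"
      by (rule infsum_nonneg) (use x0 in auto)
    ultimately show ?thesis by simp
  qed
  then show "real_semigroup t f \<in> l1w_cone w \<and> l1w_norm w (real_semigroup t f) \<le> l1w_norm w f"
    using real_semigroup_l1w[OF t f]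
      mat_app_norm_le[OF weight upper_semigroup f col_norm_semigroup[OF _ t]]
    by (auto simp: l1w_cone_def real_semigroup_def)
qed

section \<open>The generator\<close>

lemma A_dom_iff:
  fixes f :: "nat \<Rightarrow> 'b::{real_normed_field,banach}"
  shows "f \<in> A_dom w a \<longleftrightarrow> f \<in> l1w w \<and> (\<lambda>j. a j * w j * norm (f j)) summable_on {1..}"
proof -
  have "(\<lambda>n. w n * norm (of_real (a n) * f n)) summable_on {1..} \<longleftrightarrow> (\<lambda>j. a j * w j * norm (f j)) summable_on {1..}"
    by (rule summable_on_cong) (auto simp: norm_mult a_nonneg mult_ac)
  then show ?thesis
    by (auto simp: A_dom_def l1w_def)
qed

text \<open>Since the columns of \<open>B\<close> are at most \<open>\<kappa>\<close> times those of
  \<open>A\<close>, the series defining \<open>B\<close> converge on the whole domain of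
  \<open>A\<close>. Hence \<open>A + B\<close> has the domain of \<open>A\<close> and acts there as
  its matrix.\<close>

lemma A_dom_AB_op:
  fixes f :: "nat \<Rightarrow> 'b::{real_normed_field,banach}"
  assumes "f \<in> A_dom w a"
  shows "f \<in> AB_dom w a b"
    and "AB_op a b f = mat_app (\<lambda>n j. of_real (frag_mat a b n j)) f"
    and "col_summable w (\<lambda>n j. of_real (frag_mat a b n j)) f"
proof -
  have f: "f \<in> l1w w" and fs: "(\<lambda>j. a j * w j * norm (f j)) summable_on {1..}"
    using assms by (auto simp: A_dom_iff)
  define B where "B n j = (if n < j then of_real (a j * b n j) else 0 :: 'b)" for n j
  \<comment> \<open>The diagonal part is taken with positive sign, so the full matrix is
    \<open>B - A\<close>.\<close>
  define A where "A n j = (if n = j then of_real (a j) else 0 :: 'b)" for n j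
  have uB: "upper B" and uA: "upper A" by (auto simp: upper_def B_def A_def)
  have mono: "(\<lambda>j. K * (a j * w j) * norm (f j)) summable_on {1..}" for K
    using summable_on_cmult_right[OF fs, of K] by (simp add: mult.assoc)
  have sB: "col_summable w B f"
  proof (rule col_summable_comparison[OF weight mono[of \<kappa>]])
    fix j :: nat assume j: "j \<ge> 1"
    have "col_norm w B j = (\<Sum>n\<in>{1..<j}. w n * norm (B n j))"
      unfolding col_norm_def by (rule sum.mono_neutral_right) (auto simp: B_def)
    also have "\<dots> = a j * (\<Sum>n\<in>{1..<j}. w n * b n j)"
      unfolding sum_distrib_left
      by (intro sum.cong) (use j in \<open>auto simp: B_def a_nonneg b_nonneg norm_mult\<close>)
    also have "\<dots> \<le> a j * (\<kappa> * w j)"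
      by (intro mult_left_mono col_bound a_nonneg j)
    finally show "col_norm w B j \<le> \<kappa> * (a j * w j)" by (simp add: mult_ac)
  qed
  have sA: "col_summable w A f"
  proof (rule col_summable_comparison[OF weight mono[of 1]])
    fix j :: nat assume j: "j \<ge> 1"
    have "col_norm w A j = (\<Sum>n\<in>{j}. w n * norm (A n j))"
      unfolding col_norm_def by (rule sum.mono_neutral_right) (use j in \<open>auto simp: A_def\<close>)
    then show "col_norm w A j \<le> 1 * (a j * w j)"
      using a_nonneg[OF j] by (simp add: A_def)
  qed
  show "col_summable w (\<lambda>n j. of_real (frag_mat a b n j) :: 'b) f"
    by (rule col_summable_comparison[OF weight mono[of "1 + \<kappa>"]])
      (simp add: col_norm_of_real col_norm_frag_mat)
  have B_sums: "(\<lambda>i. B_term a b f n (n + 1 + i)) sums mat_app B f n" if n: "n \<ge> 1" for n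
  proof -
    have "((\<lambda>j. B n j * f j) has_sum mat_app B f n) {1..}"
      using abs_summable_summable[OF mat_row_abs_summable[OF weight uB sB n]] n
      by (simp add: mat_app_def)
    then have "((\<lambda>j. B_term a b f n j) has_sum mat_app B f n) {n+1..}"
      by (rule has_sum_cong_neutral[THEN iffD1, rotated -1]) (auto simp: B_def B_term_def)
    \<comment> \<open>Reindexing by \<open>j = n + 1 + i\<close> reaches the ordinary series in
      \<open>B_op\<close>; absolute convergence has already given unconditional summability.\<close>
    then have "((\<lambda>i. B_term a b f n (n + 1 + i)) has_sum mat_app B f n) UNIV"
      by (subst has_sum_reindex_bij_witness[of UNIV "\<lambda>j. j - (n+1)" "\<lambda>i. n + 1 + i" "{n+1..}"]) auto
    then show ?thesis by (rule has_sum_imp_sums)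
  qed
  have B_op: "B_op a b f = mat_app B f"
    using B_sums by (auto simp: B_op_def fun_eq_iff sums_iff) (simp add: mat_app_def)
  have "f \<in> B_dom w a b"
    using f B_sums mat_app_l1w(1)[OF weight uB sB]
    by (auto simp: B_dom_def B_op sums_iff)
  with assms show "f \<in> AB_dom w a b" by (simp add: AB_dom_def)
  have "mat_app A f = mat_app id_mat (\<lambda>n. of_real (a n) * f n)"
    by (rule mat_app_cong) (auto simp: A_def id_mat_def)
  also have "\<dots> = (\<lambda>n. of_real (a n) * f n)"
    by (rule mat_app_id_mat) (simp add: l1w_zero[OF f])
  finally have "AB_op a b f = (\<lambda>n. mat_app B f n - mat_app A f n)"
    by (simp add: AB_op_def A_op_def B_op)
  also have "\<dots> = mat_app (\<lambda>n j. B n j - A n j) f"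
    by (rule mat_app_diff[OF weight uB sB uA sA, symmetric])
  also have "\<dots> = mat_app (\<lambda>n j. of_real (frag_mat a b n j)) f"
    by (rule mat_app_cong) (auto simp: A_def B_def frag_mat_def)
  finally show "AB_op a b f = mat_app (\<lambda>n j. of_real (frag_mat a b n j)) f" .
qed

text \<open>Dominated convergence over the columns: entrywise the limit is the derivative of
  \<open>E\<close> at 0, and the majorant is summable against \<open>f\<close> precisely because
  \<open>f\<close> lies in the domain of \<open>A\<close>.\<close>

lemma difference_quotient_tendsto:
  fixes f :: "nat \<Rightarrow> 'b::{real_normed_field,banach}"
  assumes dom: "f \<in> A_dom w a"
  shows "((\<lambda>h. l1w_norm w (\<lambda>n. (1 / h) *\<^sub>R (real_semigroup h f n - f n) - AB_op a b f n)) \<longlongrightarrow> 0) (at_right 0)"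
proof -
  have f: "f \<in> l1w w" and fs: "(\<lambda>j. a j * w j * norm (f j)) summable_on {1..}"
    using dom by (auto simp: A_dom_iff)
  let ?M = "frag_mat a b"
  let ?Y = "\<lambda>h n j. E h n j - id_mat n j"
  let ?X = "\<lambda>h n j. (1 / h) * ?Y h n j + (-1) * ?M n j"
  \<comment> \<open>One contribution \<open>(1 + \<kappa>) * (a j * w j)\<close> bounds the
    difference quotient, the other the matrix that is subtracted.\<close>
  let ?c = "\<lambda>j. 2 * (1 + \<kappa>) * (a j * w j)"
  have uY: "upper (?Y h)" for h :: real
    using upper_lincomb[OF upper_tri_exp[of ?M h] upper_id_mat, of 1 "-1"] by simp
  have uX: "upper (?X h)" for h :: real
    by (rule upper_lincomb[OF uY upper_frag_mat])
  have "((\<lambda>h. l1w_norm w (mat_app (\<lambda>n j. of_real (?X h n j)) f)) \<longlongrightarrow> 0) (at_right 0)"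
  proof (rule mat_app_tendsto_0[OF weight, where c = ?c])
    show "(\<lambda>j. ?c j * norm (f j)) summable_on {1..}"
      using summable_on_cmult_right[OF fs, of "2 * (1 + \<kappa>)"] by (simp add: mult.assoc)
    show "\<forall>\<^sub>F h in at_right 0. upper (\<lambda>n j. of_real (?X h n j) :: 'b) \<and>
        (\<forall>j\<ge>1. col_norm w (\<lambda>n j. of_real (?X h n j) :: 'b) j \<le> ?c j)"
      using eventually_at_right_less[of 0]
    proof eventually_elim
      case (elim h)
      have "col_norm w (?X h) j \<le> ?c j" if j: "j \<ge> 1" for j
      proof -
        have "(1 / h) * col_norm w (?Y h) j \<le> (1 / h) * (h * ((1 + \<kappa>) * (a j * w j)))"
          using elim j by (intro mult_left_mono col_norm_increment) auto
        then show ?thesis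
          using col_norm_lincomb[OF weight, of "1 / h" "?Y h" "-1" ?M j] col_norm_frag_mat[OF j] elim by (simp add: algebra_simps)
      qed
      then show ?case
        using upper_of_real[OF uX[of h], where 'a = 'b] by (simp only: col_norm_of_real) blast
    qed
    fix n j :: nat assume n: "n \<ge> 1" "n \<le> j"
    have "((\<lambda>h. E h n j) has_real_derivative (\<Sum>m=1..j. id_mat n m * ?M m j)) (at 0)"
      using tri_exp_deriv[of ?M n j "0::real"] by (simp add: tri_exp_0)
    moreover have "(\<Sum>m=1..j. id_mat n m * ?M m j) = (\<Sum>m\<in>{n}. id_mat n m * ?M m j)"
      by (rule sum.mono_neutral_right) (use n in \<open>auto simp: id_mat_def\<close>)
    ultimately have "((\<lambda>h. (E h n j - id_mat n j) / h) \<longlongrightarrow> ?M n j) (at 0)"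
      by (simp add: DERIV_def tri_exp_0 id_mat_def)
    then have "((\<lambda>h. (E h n j - id_mat n j) / h - ?M n j) \<longlongrightarrow> 0) (at_right 0)"
      by (intro LIM_zero) (auto intro: filterlim_mono[OF _ order_refl at_le])
    then have "((\<lambda>h. of_real (?X h n j) :: 'b) \<longlongrightarrow> of_real 0) (at_right 0)"
      by (intro tendsto_of_real) simp
    then show "((\<lambda>h. of_real (?X h n j) :: 'b) \<longlongrightarrow> 0) (at_right 0)" by simp
  qed
  moreover have "\<forall>\<^sub>F h in at_right 0. l1w_norm w (mat_app (\<lambda>n j. of_real (?X h n j)) f)
      = l1w_norm w (\<lambda>n. (1 / h) *\<^sub>R (real_semigroup h f n - f n) - AB_op a b f n)"
    using eventually_at_right_less[of 0]
  proof eventually_elim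
    case (elim h)
    have cs1: "col_summable w (\<lambda>n j. of_real (E h n j) :: 'b) f"
      by (rule col_summable_bounded[OF weight f col_norm_semigroup]) (use elim in auto)
    have cs2: "col_summable w (id_mat :: nat \<Rightarrow> nat \<Rightarrow> 'b) f"
      by (rule col_summable_bounded[OF weight f, of _ 1]) (simp add: col_norm_id_mat)
    have Y: "mat_app (\<lambda>n j. of_real (E h n j) - id_mat n j) f = (\<lambda>n. real_semigroup h f n - f n)"
      using mat_app_diff[OF weight upper_semigroup cs1 upper_id_mat cs2] mat_app_id_mat[of f, OF l1w_zero[OF f]]
      by (simp add: real_semigroup_def)
    have uY': "upper (\<lambda>n j. of_real (E h n j) - id_mat n j :: 'b)"
      by (auto simp: upper_def id_mat_def upperD[OF upper_tri_exp])
    have csY: "col_summable w (\<lambda>n j. of_real (E h n j) - id_mat n j :: 'b) f"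
      using col_summable_lincomb[OF weight cs1 cs2, of 1 "-1"] by simp
    have "mat_app (\<lambda>n j. of_real (?X h n j)) f
        = mat_app (\<lambda>n j. of_real (1 / h) * (of_real (E h n j) - id_mat n j) + (-1) * of_real (?M n j)) f"
      by (rule mat_app_cong) (simp add: id_mat_def)
    also have "\<dots> = (\<lambda>n. of_real (1 / h) * mat_app (\<lambda>n j. of_real (E h n j) - id_mat n j) f n
        + (-1) * mat_app (\<lambda>n j. of_real (?M n j)) f n)"
      by (rule mat_app_lincomb[OF weight uY' csY upper_of_real[OF upper_frag_mat] A_dom_AB_op(3)[OF dom]])
    finally show ?case
      by (simp add: Y A_dom_AB_op(2)[OF dom] scaleR_conv_of_real)
  qed
  ultimately show ?thesis by (simp cong: tendsto_cong)
qed

text \<open>The norm lost under \<open>real_semigroup h\<close> cannot exceed the distance moved.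
  Restricting the loss to finitely many columns allows a termwise limit
  \<open>h \<rightarrow> 0\<close> before \<open>f\<close> is known to lie in the domain of
  \<open>A\<close>.\<close>

lemma dissipation:
  fixes f :: "nat \<Rightarrow> 'b::{real_normed_field,banach}"
  assumes f: "f \<in> l1w w" and h: "h > 0" and F: "finite F" "F \<subseteq> {1..}"
  shows "(1 - \<kappa>) * (\<Sum>j\<in>F. w j * norm (f j) * ((1 - exp (- (a j * h))) / h))
    \<le> l1w_norm w (\<lambda>n. (1 / h) *\<^sub>R (real_semigroup h f n - f n))"
proof -
  define x where "x j = exp (- (a j * h))" for j
  have x: "0 \<le> x j" "x j \<le> 1" if "j \<ge> 1" for j
    using a_nonneg[OF that] h by (auto simp: x_def)
  let ?X = "\<lambda>n j. of_real (E h n j) :: 'b"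
  have cs: "col_summable w ?X f"
    by (rule col_summable_bounded[OF weight f col_norm_semigroup]) (use h in auto)
  have S: "real_semigroup h f \<in> l1w w"
    using h f by (intro real_semigroup_l1w) auto
  have D: "(\<lambda>n. real_semigroup h f n - f n) \<in> l1w w"
    by (rule l1w_diff(1)[OF weight S f])
  have sub: "f = (\<lambda>n. real_semigroup h f n - (real_semigroup h f n - f n))" by simp
  have "l1w_norm w f \<le> l1w_norm w (real_semigroup h f) + l1w_norm w (\<lambda>n. real_semigroup h f n - f n)"
    by (subst sub) (rule l1w_diff(2)[OF weight S D])
  moreover have "l1w_norm w (real_semigroup h f) \<le> (\<Sum>\<^sub>\<infinity>j\<in>{1..}. col_norm w ?X j * norm (f j))"
    unfolding real_semigroup_def by (rule mat_app_l1w(2)[OF weight upper_semigroup cs])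
  moreover have "(1 - \<kappa>) * (\<Sum>j\<in>F. w j * norm (f j) * (1 - x j))
      \<le> l1w_norm w f - (\<Sum>\<^sub>\<infinity>j\<in>{1..}. col_norm w ?X j * norm (f j))"
  proof -
    \<comment> \<open>By \<open>col_norm_real\<close> the loss in column \<open>j\<close> is at
      least \<open>w j - w j * (x j + \<kappa> * (1 - x j))\<close>, which factors as
      \<open>(1 - \<kappa>) * w j * (1 - x j)\<close>.\<close>
    have pt: "(1 - \<kappa>) * (w j * norm (f j) * (1 - x j)) \<le> w j * norm (f j) - col_norm w ?X j * norm (f j)"
      if "j \<ge> 1" for j
    proof -
      have "col_norm w ?X j * norm (f j) \<le> w j * (x j + \<kappa> * (1 - x j)) * norm (f j)"
        using col_norm_real[of j h] that h
        by (intro mult_right_mono) (auto simp: col_norm_of_real x_def)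
      then show ?thesis by (simp add: algebra_simps)
    qed
    have nn: "0 \<le> (1 - \<kappa>) * (w j * norm (f j) * (1 - x j))" if "j \<ge> 1" for j
      using kappa x[OF that] w_pos[OF that] by (intro mult_nonneg_nonneg) auto
    have s1: "(\<lambda>j. w j * norm (f j) + - (col_norm w ?X j * norm (f j))) summable_on {1..}"
      using cs l1w_summable[OF f] by (intro summable_on_add) (auto simp: col_summable_def summable_on_uminus)
    have "(\<Sum>j\<in>F. (1 - \<kappa>) * (w j * norm (f j) * (1 - x j)))
        \<le> (\<Sum>j\<in>F. w j * norm (f j) + - (col_norm w ?X j * norm (f j)))"
      using pt F by (intro sum_mono) auto
    also have "\<dots> \<le> (\<Sum>\<^sub>\<infinity>j\<in>{1..}. w j * norm (f j) + - (col_norm w ?X j * norm (f j)))"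
      by (rule finite_sum_le_infsum[OF s1 F]) (use pt nn order_trans in fastforce)
    also have "\<dots> = l1w_norm w f - (\<Sum>\<^sub>\<infinity>j\<in>{1..}. col_norm w ?X j * norm (f j))"
      using cs l1w_summable[OF f]
      by (subst infsum_add) (auto simp: col_summable_def summable_on_uminus infsum_uminus l1w_norm_def)
    finally show ?thesis by (simp add: sum_distrib_left)
  qed
  ultimately have "(1 - \<kappa>) * (\<Sum>j\<in>F. w j * norm (f j) * (1 - x j)) \<le> l1w_norm w (\<lambda>n. real_semigroup h f n - f n)"
    by linarith
  then have "(1 / h) * ((1 - \<kappa>) * (\<Sum>j\<in>F. w j * norm (f j) * (1 - x j)))
      \<le> (1 / h) * l1w_norm w (\<lambda>n. real_semigroup h f n - f n)"
    using h by (intro mult_left_mono) auto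
  also have "\<dots> = l1w_norm w (\<lambda>n. (1 / h) *\<^sub>R (real_semigroup h f n - f n))"
    using l1w_norm_scale[of w "of_real (1 / h)" "\<lambda>n. real_semigroup h f n - f n"] h
    by (simp add: scaleR_conv_of_real norm_divide)
  finally show ?thesis
    by (simp add: x_def sum_distrib_left mult_ac)
qed

text \<open>In the limit \<open>h \<rightarrow> 0\<close> the dissipation estimate bounds every
  finite partial sum of \<open>a j * w j * norm (f j)\<close> by
  \<open>l1w_norm w g / (1 - \<kappa>)\<close>. The strict inequality \<open>\<kappa> < 1\<close> is
  what makes this a bound.\<close>

lemma generator_domain:
  fixes f g :: "nat \<Rightarrow> 'b::{real_normed_field,banach}"
  assumes f: "f \<in> l1w w" and g: "g \<in> l1w w"
    and lim: "((\<lambda>h. l1w_norm w (\<lambda>n. (1 / h) *\<^sub>R (real_semigroup h f n - f n) - g n)) \<longlongrightarrow> 0) (at_right 0)"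
  shows "f \<in> A_dom w a"
proof -
  let ?D = "\<lambda>h n. (1 / h) *\<^sub>R (real_semigroup h f n - f n)"
  have D: "?D h \<in> l1w w" if "h > 0" for h
    unfolding scaleR_conv_of_real using that
    by (intro l1w_scale l1w_diff(1)[OF weight] real_semigroup_l1w f) auto
  have bound: "(1 - \<kappa>) * (\<Sum>j\<in>F. w j * norm (f j) * a j) \<le> l1w_norm w g" if F: "finite F" "F \<subseteq> {1..}" for F
  proof (rule tendsto_le)
    show "at_right (0::real) \<noteq> bot" by simp
    show "((\<lambda>h. l1w_norm w (\<lambda>n. ?D h n - g n) + l1w_norm w g) \<longlongrightarrow> l1w_norm w g) (at_right 0)"
      using tendsto_add[OF lim tendsto_const[of "l1w_norm w g"]] by simp
    have "((\<lambda>h. (1 - exp (- (a j * h))) / h) \<longlongrightarrow> a j) (at_right 0)" for j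
    proof -
      have "((\<lambda>h. - exp (- (a j * h))) has_real_derivative a j) (at 0)"
        by (rule derivative_eq_intros refl | simp)+
      then have "((\<lambda>h. (1 - exp (- (a j * h))) / h) \<longlongrightarrow> a j) (at 0)"
        by (simp add: DERIV_def add.commute)
      then show ?thesis by (auto intro: filterlim_mono[OF _ order_refl at_le])
    qed
    then show "((\<lambda>h. (1 - \<kappa>) * (\<Sum>j\<in>F. w j * norm (f j) * ((1 - exp (- (a j * h))) / h)))
        \<longlongrightarrow> (1 - \<kappa>) * (\<Sum>j\<in>F. w j * norm (f j) * a j)) (at_right 0)"
      by (intro tendsto_mult tendsto_const tendsto_sum)
    show "\<forall>\<^sub>F h in at_right 0. (1 - \<kappa>) * (\<Sum>j\<in>F. w j * norm (f j) * ((1 - exp (- (a j * h))) / h))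
        \<le> l1w_norm w (\<lambda>n. ?D h n - g n) + l1w_norm w g"
      using eventually_at_right_less[of 0]
    proof eventually_elim
      case (elim h)
      have "l1w_norm w (?D h) \<le> l1w_norm w (\<lambda>n. ?D h n - g n) + l1w_norm w g"
        using l1w_add(2)[OF weight l1w_diff(1)[OF weight D[OF elim] g] g] by simp
      then show ?case using dissipation[OF f elim F] by linarith
    qed
  qed
  have "(\<lambda>j. a j * w j * norm (f j)) summable_on {1..}"
  proof (rule nonneg_bdd_above_summable_on)
    show "0 \<le> a j * w j * norm (f j)" if "j \<in> {1..}" for j
      using that a_nonneg[of j] w_pos[of j] by simp
    show "bdd_above (sum (\<lambda>j. a j * w j * norm (f j)) ` {F. F \<subseteq> {1..} \<and> finite F})"
    proof (rule bdd_aboveI2)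
      fix F :: "nat set" assume "F \<in> {F. F \<subseteq> {1..} \<and> finite F}"
      then show "(\<Sum>j\<in>F. a j * w j * norm (f j)) \<le> l1w_norm w g / (1 - \<kappa>)"
        using bound[of F] kappa by (simp add: pos_le_divide_eq mult_ac)
    qed
  qed
  with f show ?thesis by (simp add: A_dom_iff)
qed

text \<open>One direction is convergence of the difference quotients on the domain of
  \<open>A\<close>. For the other, \<open>generator_domain\<close> puts \<open>f\<close> into that
  domain, and uniqueness of the limit identifies \<open>g\<close>.\<close>

lemma is_generator_real_semigroup:
  "is_generator w (AB_dom w a b) (AB_op a b)
    (real_semigroup :: real \<Rightarrow> (nat \<Rightarrow> 'b::{real_normed_field,banach}) \<Rightarrow> nat \<Rightarrow> 'b)"
  unfolding is_generator_def
proof (intro allI iffI)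
  fix f g :: "nat \<Rightarrow> 'b"
  let ?D = "\<lambda>h n. (1 / h) *\<^sub>R (real_semigroup h f n - f n)"
  {
    assume "f \<in> AB_dom w a b \<and> g = AB_op a b f"
    then have dom: "f \<in> A_dom w a" and g: "g = AB_op a b f" by (auto simp: AB_dom_def)
    have "g \<in> l1w w"
      unfolding g A_dom_AB_op(2)[OF dom]
      by (rule mat_app_l1w(1)[OF weight upper_of_real[OF upper_frag_mat] A_dom_AB_op(3)[OF dom]])
    then show "f \<in> l1w w \<and> g \<in> l1w w \<and> ((\<lambda>h. l1w_norm w (\<lambda>n. ?D h n - g n)) \<longlongrightarrow> 0) (at_right 0)"
      using difference_quotient_tendsto[OF dom] dom by (simp add: g A_dom_iff)
  }
  assume *: "f \<in> l1w w \<and> g \<in> l1w w \<and> ((\<lambda>h. l1w_norm w (\<lambda>n. ?D h n - g n)) \<longlongrightarrow> 0) (at_right 0)"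
  then have f: "f \<in> l1w w" and g: "g \<in> l1w w" by auto
  have dom: "f \<in> A_dom w a" using generator_domain * by blast
  define G where "G = AB_op a b f"
  have G: "G \<in> l1w w"
    unfolding G_def A_dom_AB_op(2)[OF dom]
    by (rule mat_app_l1w(1)[OF weight upper_of_real[OF upper_frag_mat] A_dom_AB_op(3)[OF dom]])
  have D: "?D h \<in> l1w w" if "h > 0" for h
    unfolding scaleR_conv_of_real using that
    by (intro l1w_scale l1w_diff(1)[OF weight] real_semigroup_l1w f) auto
  \<comment> \<open>Uniqueness of limits in norm: the quotients converge to \<open>G\<close> and to
    \<open>g\<close>, so the triangle inequality forces their distance to be 0.\<close>
  have "l1w_norm w (\<lambda>n. G n - g n) \<le> 0 + 0"
  proof (rule tendsto_lowerbound)
    show "((\<lambda>h. l1w_norm w (\<lambda>n. ?D h n - g n) + l1w_norm w (\<lambda>n. ?D h n - G n)) \<longlongrightarrow> 0 + 0) (at_right 0)"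
      using * difference_quotient_tendsto[OF dom] by (intro tendsto_add) (auto simp: G_def)
    show "\<forall>\<^sub>F h in at_right 0. l1w_norm w (\<lambda>n. G n - g n)
        \<le> l1w_norm w (\<lambda>n. ?D h n - g n) + l1w_norm w (\<lambda>n. ?D h n - G n)"
      using eventually_at_right_less[of 0]
    proof eventually_elim
      case (elim h)
      show ?case
        using l1w_diff(2)[OF weight l1w_diff(1)[OF weight D[OF elim] g] l1w_diff(1)[OF weight D[OF elim] G]]
        by simp
    qed
  qed simp
  then have "(\<lambda>n. G n - g n) = (\<lambda>n. 0)"
    by (intro l1w_norm_eq_0[OF weight] l1w_diff(1)[OF weight] G g) simp
  then have "g = G" by (auto simp: fun_eq_iff)
  then show "f \<in> AB_dom w a b \<and> g = AB_op a b f"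
    using A_dom_AB_op(1)[OF dom] by (simp add: G_def)
qed

section \<open>Analyticity\<close>

text \<open>The product of \<open>E z\<close> with the matrix of \<open>A + B\<close>, that is, the
  entrywise complex derivative of \<open>E\<close> at \<open>z\<close>.\<close>

definition exp_deriv :: "complex \<Rightarrow> nat \<Rightarrow> nat \<Rightarrow> complex" where
  "exp_deriv z n j = (\<Sum>m=1..j. E z n m * of_real (frag_mat a b m j))"

lemma upper_exp_deriv: "upper (exp_deriv z)"
  by (auto simp: upper_def exp_deriv_def upperD[OF upper_tri_exp] intro!: sum.neutral)

text \<open>Cauchy's estimates for the scalar functions \<open>\<Sum>n. w n * \<sigma> n * E z n j\<close>, with unimodular \<open>\<sigma>\<close>
  chosen to produce the column norm, are uniform in \<open>j\<close>; this is holomorphy in operator norm.\<close>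

lemma functional_Cauchy_bounds:
  fixes \<sigma> :: "nat \<Rightarrow> complex"
  assumes \<rho>: "\<rho> > 0" and ball: "\<And>u. u \<in> cball z (2 * \<rho>) \<Longrightarrow> \<kappa> * norm u < Re u"
    and \<sigma>: "\<And>n. norm (\<sigma> n) \<le> 1" and j: "j \<ge> 1"
  defines "\<phi> \<equiv> \<lambda>u. \<Sum>n=1..j. of_real (w n) * \<sigma> n * E u n j"
    and "\<phi>' \<equiv> \<Sum>n=1..j. of_real (w n) * \<sigma> n * exp_deriv z n j"
  shows "norm \<phi>' \<le> w j / \<rho>"
    and "norm h \<le> \<rho> \<Longrightarrow> norm (\<phi> (z + h) - \<phi> z - \<phi>' * h) \<le> 2 * w j / \<rho>\<^sup>2 * (norm h)\<^sup>2"
proof -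
  have deriv: "(\<phi> has_field_derivative (\<Sum>n=1..j. of_real (w n) * \<sigma> n * exp_deriv u n j)) (at u)" for u
    unfolding \<phi>_def exp_deriv_def by (intro DERIV_sum DERIV_cmult tri_exp_deriv)
  have hol: "\<phi> holomorphic_on S" for S
    using deriv by (meson field_differentiable_at_within field_differentiable_def holomorphic_on_def)
  have bound: "norm (\<phi> u) \<le> w j" if "u \<in> cball z (2 * \<rho>)" for u
  proof -
    have "norm (\<phi> u) \<le> col_norm w (E u) j"
      unfolding \<phi>_def col_norm_def
    proof (rule sum_norm_le)
      fix n assume "n \<in> {1..j}"
      then have "0 < w n" using w_pos by simp
      then show "norm (of_real (w n) * \<sigma> n * E u n j) \<le> w n * norm (E u n j)"
        using mult_right_mono[OF \<sigma>[of n], of "w n * norm (E u n j)"] by (simp add: norm_mult mult_ac)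
    qed
    also have "\<dots> \<le> w j" by (rule col_norm_cone[OF ball[OF that] j])
    finally show ?thesis .
  qed
  \<comment> \<open>Circles of radius \<open>\<rho>\<close> around points of
    \<open>cball z \<rho>\<close> stay inside \<open>cball z (2 * \<rho>)\<close>, where
    \<open>\<phi>\<close> is bounded by \<open>w j\<close>; hence the doubled radius in the
    hypothesis.\<close>
  have Cauchy: "norm ((deriv ^^ k) \<phi> u) \<le> fact k * w j / \<rho> ^ k" if "u \<in> cball z \<rho>" for u k
  proof (rule Cauchy_inequality[OF hol _ \<rho>])
    show "continuous_on (cball u \<rho>) \<phi>" by (rule holomorphic_on_imp_continuous_on[OF hol])
    fix x assume "norm (u - x) = \<rho>"
    then have "x \<in> cball z (2 * \<rho>)"
      using that dist_triangle[of z x u] by (simp add: dist_norm)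
    then show "norm (\<phi> x) \<le> w j" by (rule bound)
  qed
  have d1: "deriv \<phi> z = \<phi>'"
    unfolding \<phi>'_def by (rule DERIV_imp_deriv[OF deriv])
  show "norm \<phi>' \<le> w j / \<rho>"
    using Cauchy[of z 1] \<rho> by (simp add: d1)
  assume h: "norm h \<le> \<rho>"
  \<comment> \<open>First-order Taylor expansion; the constant is the Cauchy estimate for the second
    derivative on \<open>cball z \<rho>\<close>.\<close>
  have "norm ((deriv ^^ 0) \<phi> (z + h) - (\<Sum>i\<le>1. (deriv ^^ i) \<phi> z * (z + h - z) ^ i / fact i))
      \<le> 2 * w j / \<rho>\<^sup>2 * norm (z + h - z) ^ Suc 1 / fact 1"
  proof (rule complex_Taylor[of "cball z \<rho>"])
    fix i x
    have "(deriv ^^ i) \<phi> holomorphic_on UNIV"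
      by (rule holomorphic_higher_deriv[OF hol open_UNIV])
    then have "(deriv ^^ i) \<phi> field_differentiable at x"
      by (simp add: holomorphic_on_def)
    then show "((deriv ^^ i) \<phi> has_field_derivative (deriv ^^ Suc i) \<phi> x) (at x within cball z \<rho>)"
      by (simp add: DERIV_deriv_iff_field_differentiable has_field_derivative_at_within)
  next
    fix x assume "x \<in> cball z \<rho>"
    then show "norm ((deriv ^^ Suc 1) \<phi> x) \<le> 2 * w j / \<rho>\<^sup>2"
      using Cauchy[of x 2] by (simp add: numeral_2_eq_2)
  qed (use h \<rho> in \<open>auto simp: dist_norm\<close>)
  then show "norm (\<phi> (z + h) - \<phi> z - \<phi>' * h) \<le> 2 * w j / \<rho>\<^sup>2 * (norm h)\<^sup>2"
    by (simp add: d1 algebra_simps power2_eq_square)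
qed

lemma col_norm_as_functional:
  assumes "\<And>n. \<sigma> n = cnj (sgn (X n j))"
  shows "(\<Sum>n=1..j. of_real (w n) * \<sigma> n * X n j) = of_real (col_norm w X j)"
  by (simp add: col_norm_def mult.assoc cnj_sgn_mult assms)

lemma col_norm_exp_deriv:
  assumes \<rho>: "\<rho> > 0" and ball: "\<And>u. u \<in> cball z (2 * \<rho>) \<Longrightarrow> \<kappa> * norm u < Re u" and j: "j \<ge> 1"
  shows "col_norm w (exp_deriv z) j \<le> 1 / \<rho> * w j"
  using functional_Cauchy_bounds(1)[OF \<rho> ball _ j, where \<sigma> = "\<lambda>n. cnj (sgn (exp_deriv z n j))" and z = z]
    col_norm_as_functional[of "\<lambda>n. cnj (sgn (exp_deriv z n j))" "exp_deriv z" j]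
    col_norm_nonneg[OF weight, of "exp_deriv z" j]
  by (simp add: norm_sgn)

text \<open>The second-order Taylor estimate divided by \<open>norm h\<close>. The signs depend on
  \<open>h\<close> and \<open>j\<close>, which is harmless because that estimate is uniform in
  \<open>\<sigma>\<close>.\<close>

lemma col_norm_exp_remainder:
  assumes \<rho>: "\<rho> > 0" and ball: "\<And>u. u \<in> cball z (2 * \<rho>) \<Longrightarrow> \<kappa> * norm u < Re u" and j: "j \<ge> 1"
    and h: "norm h \<le> \<rho>" "h \<noteq> 0"
  shows "col_norm w (\<lambda>n j. (E (z + h) n j - E z n j) / h - exp_deriv z n j) j \<le> 2 / \<rho>\<^sup>2 * norm h * w j"
proof -
  let ?R = "\<lambda>n j. (E (z + h) n j - E z n j) / h - exp_deriv z n j"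
  let ?\<sigma> = "\<lambda>n. cnj (sgn (?R n j))"
  let ?\<phi> = "\<lambda>X. \<Sum>n=1..j. of_real (w n) * ?\<sigma> n * X n j"
  \<comment> \<open>Linearity is shown for abstract \<open>c\<close>, \<open>X\<close>,
    \<open>Y\<close>, \<open>Z\<close>, since the signs to be inserted for \<open>c\<close>
    themselves contain the matrices.\<close>
  have "(\<Sum>n=1..j. c n * ((X n j - Y n j) / h - Z n j))
      = ((\<Sum>n=1..j. c n * X n j) - (\<Sum>n=1..j. c n * Y n j) - (\<Sum>n=1..j. c n * Z n j) * h) / h"
    for c and X Y Z :: "nat \<Rightarrow> nat \<Rightarrow> complex"
    using h(2) unfolding sum_subtractf[symmetric] sum_divide_distrib sum_distrib_right
    by (intro sum.cong) (auto simp: field_simps)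
  from this[of "\<lambda>n. of_real (w n) * ?\<sigma> n" "E (z + h)" "E z" "exp_deriv z"]
  have "?\<phi> ?R = (?\<phi> (E (z + h)) - ?\<phi> (E z) - ?\<phi> (exp_deriv z) * h) / h" .
  moreover have "norm (?\<phi> (E (z + h)) - ?\<phi> (E z) - ?\<phi> (exp_deriv z) * h) \<le> 2 * w j / \<rho>\<^sup>2 * (norm h)\<^sup>2"
    by (rule functional_Cauchy_bounds(2)[OF \<rho> ball _ j h(1)]) (auto simp: norm_sgn)
  ultimately have "norm (?\<phi> ?R) \<le> 2 * w j / \<rho>\<^sup>2 * (norm h)\<^sup>2 / norm h"
    by (simp only: norm_divide divide_right_mono norm_ge_zero)
  moreover have "?\<phi> ?R = of_real (col_norm w ?R j)"
    by (rule col_norm_as_functional) simp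
  ultimately show ?thesis
    using col_norm_nonneg[OF weight, of ?R j] h(2) by (simp add: power2_eq_square mult_ac)
qed

lemma op_norm_le:
  assumes T: "\<And>f. f \<in> l1w w \<Longrightarrow> l1w_norm w (T f) \<le> C * l1w_norm w f" and "C \<ge> 0"
  shows "\<bar>op_norm w (T :: (nat \<Rightarrow> 'b::real_normed_field) \<Rightarrow> nat \<Rightarrow> 'b)\<bar> \<le> C"
proof -
  let ?U = "{f :: nat \<Rightarrow> 'b. f \<in> l1w w \<and> l1w_norm w f \<le> 1}"
  have le: "l1w_norm w (T f) \<le> C" if "f \<in> ?U" for f
  proof -
    have "l1w_norm w (T f) \<le> C * l1w_norm w f" using that T by simp
    also have "\<dots> \<le> C * 1" using that \<open>C \<ge> 0\<close> by (intro mult_left_mono) auto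
    finally show ?thesis by simp
  qed
  \<comment> \<open>The zero sequence makes the index set of the supremum nonempty and also
    witnesses that the supremum is nonnegative.\<close>
  have zero: "(\<lambda>_. 0) \<in> ?U" by (simp add: l1w_def l1w_norm_def)
  have "op_norm w T \<le> C"
    unfolding op_norm_def using zero le by (intro cSUP_least) auto
  moreover have "0 \<le> op_norm w T"
    unfolding op_norm_def using zero le l1w_norm_nonneg[OF weight]
    by (intro cSUP_upper2[of _ _ "\<lambda>_. 0"] bdd_aboveI2) auto
  ultimately show ?thesis by simp
qed

text \<open>The quotient \<open>Re z / norm z\<close> is the cosine of \<open>Arg z\<close>, so the
  cone of contraction contains the sector of half-angle \<open>arccos \<kappa>\<close>.\<close>

lemma sector_cone:
  assumes "z \<in> sector (arccos \<kappa>)"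
  shows "\<kappa> * norm z < Re z"
proof -
  have z: "z \<noteq> 0" "\<bar>Arg z\<bar> < arccos \<kappa>" using assms by (auto simp: sector_def)
  have "cos (arccos \<kappa>) < cos \<bar>Arg z\<bar>"
    using z kappa by (intro cos_monotone_0_pi arccos_ubound) auto
  then have "\<kappa> < Re z / norm z"
    using kappa z by (simp add: cos_Arg)
  then show ?thesis using z by (simp add: pos_less_divide_eq)
qed

text \<open>The extension is the same matrix exponential at complex \<open>z\<close>. The angle
  \<open>arccos \<kappa>\<close> is positive because \<open>\<kappa> < 1\<close> and at most
  \<open>pi / 2\<close> because \<open>0 \<le> \<kappa>\<close>.\<close>

lemma analytic_real_semigroup: "analytic_semigroup w real_semigroup"
  unfolding analytic_semigroup_def
proof (intro exI[of _ "arccos \<kappa>"] exI[of _ "\<lambda>z. mat_app (E z)"] conjI allI impI ballI)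
  show "0 < arccos \<kappa>"
    using arccos_lt_bounded[of \<kappa>] kappa by simp
  show "arccos \<kappa> \<le> pi / 2"
    using arccos_le_arccos[of 0 \<kappa>] kappa by simp
next
  fix t :: real and f :: "nat \<Rightarrow> complex"
  show "mat_app (E (of_real t)) f = real_semigroup t f"
    by (simp add: real_semigroup_eq)
next
  fix z assume z: "z \<in> sector (arccos \<kappa>)"
  note cone = col_norm_cone[OF sector_cone[OF z]]
  show "bounded_op w (mat_app (E z))"
    by (rule bounded_op_mat_app[OF weight upper_tri_exp, of _ _ 1]) (simp add: cone)
  have "open {u. \<kappa> * norm u < Re u}"
    by (intro open_Collect_less continuous_intros)
  then obtain r where r: "r > 0" "cball z r \<subseteq> {u. \<kappa> * norm u < Re u}"
    using sector_cone[OF z] by (auto simp: open_contains_cball)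
  define \<rho> where "\<rho> = r / 2"
  have \<rho>: "\<rho> > 0" and ball: "\<And>u. u \<in> cball z (2 * \<rho>) \<Longrightarrow> \<kappa> * norm u < Re u"
    using r by (auto simp: \<rho>_def)
  note D = col_norm_exp_deriv[OF \<rho> ball]
  show "\<exists>T'. bounded_op w T' \<and>
      ((\<lambda>h. op_norm w (\<lambda>f n. (mat_app (E (z + h)) f n - mat_app (E z) f n) / h - T' f n)) \<longlongrightarrow> 0) (at 0)"
  proof (intro exI[of _ "mat_app (exp_deriv z)"] conjI)
    show "bounded_op w (mat_app (exp_deriv z))"
      by (rule bounded_op_mat_app[OF weight upper_exp_deriv D])
    have lim: "((\<lambda>h. 2 / \<rho>\<^sup>2 * norm h) \<longlongrightarrow> 0) (at (0 :: complex))"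
      by (intro tendsto_mult_right_zero tendsto_norm_zero tendsto_ident_at)
    have "\<forall>\<^sub>F h in at 0. h \<noteq> 0 \<and> norm h \<le> \<rho>"
      using \<rho> by (auto simp: eventually_at intro!: exI[of _ \<rho>])
    then have "\<forall>\<^sub>F h in at 0. norm (op_norm w (\<lambda>f n. (mat_app (E (z + h)) f n - mat_app (E z) f n) / h
        - mat_app (exp_deriv z) f n)) \<le> 2 / \<rho>\<^sup>2 * norm h"
    proof eventually_elim
      case (elim h)
      let ?R = "\<lambda>n j. (E (z + h) n j - E z n j) / h - exp_deriv z n j"
      have uR: "upper ?R"
        by (simp add: upper_def upperD[OF upper_tri_exp] upperD[OF upper_exp_deriv])
      have zh: "\<kappa> * norm (z + h) < Re (z + h)"
        by (rule ball) (use elim \<rho> in \<open>auto simp: dist_norm\<close>)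
      show ?case
        unfolding real_norm_def
      proof (rule op_norm_le)
        fix f :: "nat \<Rightarrow> complex" assume f: "f \<in> l1w w"
        have cs: "col_summable w (E u) f" if "\<kappa> * norm u < Re u" for u
          by (rule col_summable_bounded[OF weight f, of _ 1]) (simp add: col_norm_cone[OF that])
        have u1: "upper (\<lambda>n j. E (z + h) n j - E z n j)"
          by (simp add: upper_def upperD[OF upper_tri_exp])
        have c1: "col_summable w (\<lambda>n j. E (z + h) n j - E z n j) f"
          using col_summable_lincomb[OF weight cs[OF zh] cs[OF sector_cone[OF z]], of 1 "-1"] by simp
        have "mat_app ?R f = mat_app (\<lambda>n j. inverse h * (E (z + h) n j - E z n j) + (-1) * exp_deriv z n j) f"
          by (simp add: divide_inverse mult.commute)
        also have "\<dots> = (\<lambda>n. inverse h * mat_app (\<lambda>n j. E (z + h) n j - E z n j) f n + (-1) * mat_app (exp_deriv z) f n)"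
          by (rule mat_app_lincomb[OF weight u1 c1 upper_exp_deriv col_summable_bounded[OF weight f D]])
        also have "mat_app (\<lambda>n j. E (z + h) n j - E z n j) f = (\<lambda>n. mat_app (E (z + h)) f n - mat_app (E z) f n)"
          by (intro mat_app_diff[OF weight] upper_tri_exp cs zh sector_cone z)
        finally have "mat_app ?R f = (\<lambda>n. (mat_app (E (z + h)) f n - mat_app (E z) f n) / h - mat_app (exp_deriv z) f n)"
          by (simp add: divide_inverse mult.commute)
        moreover have "l1w_norm w (mat_app ?R f) \<le> 2 / \<rho>\<^sup>2 * norm h * l1w_norm w f"
          by (rule mat_app_norm_le[OF weight uR f]) (rule col_norm_exp_remainder[OF \<rho> ball], use elim in auto)
        ultimately show "l1w_norm w (\<lambda>n. (mat_app (E (z + h)) f n - mat_app (E z) f n) / h - mat_app (exp_deriv z) f n)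
            \<le> 2 / \<rho>\<^sup>2 * norm h * l1w_norm w f"
          by simp
      qed simp
    qed
    then show "((\<lambda>h. op_norm w (\<lambda>f n. (mat_app (E (z + h)) f n - mat_app (E z) f n) / h
        - mat_app (exp_deriv z) f n)) \<longlongrightarrow> 0) (at 0)"
      by (rule Lim_null_comparison[OF _ lim])
  qed
  fix z' and f :: "nat \<Rightarrow> complex" assume z': "z' \<in> sector (arccos \<kappa>)" and f: "f \<in> l1w w"
  show "mat_app (E (z + z')) f = mat_app (E z) (mat_app (E z') f)"
    by (intro exp_semigroup_law col_norm_cone sector_cone z z' f)
next
  fix f :: "nat \<Rightarrow> complex" assume f: "f \<in> l1w w"
  have "\<forall>\<^sub>F z in at 0 within sector (arccos \<kappa>). \<forall>j\<ge>1. col_norm w (E z) j \<le> w j"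
    by (auto simp: eventually_at_filter intro!: always_eventually col_norm_cone sector_cone)
  then show "((\<lambda>z. l1w_norm w (\<lambda>n. mat_app (E z) f n - f n)) \<longlongrightarrow> 0) (at 0 within sector (arccos \<kappa>))"
    by (rule exp_strongly_continuous[OF tendsto_ident_at _ f])
qed

lemma generates: "generates_analytic_substochastic w a b"
  unfolding generates_analytic_substochastic_def
  by (intro conjI exI[of _ real_semigroup] C0_real_semigroup is_generator_real_semigroup
      substochastic_real_semigroup analytic_real_semigroup)

end

section \<open>Choice of the weight\<close>

text \<open>Only earlier weights enter the sum for column \<open>j\<close>, so the required
  inequality can be solved recursively: the sum equals half of the weight minus 1, which gives
  \<open>\<kappa> = 1 / 2\<close>. The summand 1 keeps the weight positive.\<close>

fun dominating_weight :: "(nat \<Rightarrow> nat \<Rightarrow> real) \<Rightarrow> nat \<Rightarrow> real" where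
  "dominating_weight b j = 1 + 2 * (\<Sum>n\<in>{1..<j}. dominating_weight b n * b n j)"

declare dominating_weight.simps [simp del]

lemma dominating_weight_pos:
  assumes "\<And>n j. n \<ge> 1 \<Longrightarrow> j \<ge> 1 \<Longrightarrow> b n j \<ge> 0"
  shows "j \<ge> 1 \<Longrightarrow> dominating_weight b j > 0"
proof (induction j rule: less_induct)
  case (less j)
  have "(\<Sum>n\<in>{1..<j}. dominating_weight b n * b n j) \<ge> 0"
    using less assms by (intro sum_nonneg mult_nonneg_nonneg) (auto intro: less_imp_le)
  then show ?case by (subst dominating_weight.simps) simp
qed

text \<open>The sequence \<open>r ^ n / n\<close> is nondecreasing for \<open>r > 2\<close>, so with
  \<open>k = j - 1\<close> each \<open>r ^ n\<close> is at most \<open>n / k * r ^ k\<close>, and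
  the hypothesis \<open>mass\<close> sums these bounds.\<close>

lemma geometric_weight_bound:
  fixes r :: real
  assumes r: "r > 2" and b: "\<And>n j. n \<ge> 1 \<Longrightarrow> j \<ge> 1 \<Longrightarrow> b n j \<ge> 0"
    and mass: "(\<Sum>n=1..j-1. real n * b n j) \<le> real j" and j: "j \<ge> 2"
  shows "(\<Sum>n=1..j-1. r ^ n * b n j) \<le> 2 / r * r ^ j"
proof -
  obtain k where k: "j = Suc k" "k \<ge> 1" using j by (cases j) auto
  have mono: "r ^ n * real k \<le> real n * r ^ k" if "1 \<le> n" "n \<le> k" for n
    using that(2)
  proof (induction k rule: dec_induct)
    case (step m)
    have "real (Suc m) \<le> 2 * real m" using that step by simp
    also have "\<dots> \<le> r * real m" using r by (intro mult_right_mono) auto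
    finally have "r ^ n * real (Suc m) \<le> r ^ n * (r * real m)"
      using r by (intro mult_left_mono) auto
    also have "\<dots> \<le> r * (real n * r ^ m)"
      using step.IH r by (simp add: mult.left_commute)
    finally show ?case by (simp add: mult_ac)
  qed simp
  have "real k * (\<Sum>n=1..k. r ^ n * b n j) = (\<Sum>n=1..k. (r ^ n * real k) * b n j)"
    by (simp add: sum_distrib_left mult_ac)
  also have "\<dots> \<le> (\<Sum>n=1..k. (real n * r ^ k) * b n j)"
    using b j mono by (intro sum_mono mult_right_mono) auto
  also have "\<dots> = r ^ k * (\<Sum>n=1..k. real n * b n j)"
    by (simp add: sum_distrib_left mult_ac)
  also have "\<dots> \<le> r ^ k * real j"
    using mass r k by (intro mult_left_mono) auto
  \<comment> \<open>Here \<open>j = k + 1 \<le> 2 * k\<close>, which is the source of the 2 in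
    \<open>2 / r\<close>.\<close>
  also have "\<dots> \<le> r ^ k * (2 * real k)"
    using r k by (intro mult_left_mono) auto
  finally have "real k * (\<Sum>n=1..k. r ^ n * b n j) \<le> real k * (2 * r ^ k)"
    by (simp add: mult_ac)
  then have "(\<Sum>n=1..k. r ^ n * b n j) \<le> 2 * r ^ k"
    using k by simp
  moreover have "2 / r * r ^ j = 2 * r ^ k"
    using r by (simp add: k(1))
  ultimately show ?thesis by (simp add: k(1))
qed

text \<open>Both claims are instances of \<open>fragmentation\<close>:
  \<open>dominating_weight b\<close> with constant \<open>1 / 2\<close>, and the geometric weight
  with \<open>2 / r\<close>, which is below 1 because \<open>r > 2\<close>.\<close>

theorem theorem5p5:
  fixes a :: "nat \<Rightarrow> real" and b :: "nat \<Rightarrow> nat \<Rightarrow> real"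
  assumes a_nonneg: "\<And>n. n \<ge> 1 \<Longrightarrow> a n \<ge> 0"
    and b_nonneg: "\<And>n j. n \<ge> 1 \<Longrightarrow> j \<ge> 1 \<Longrightarrow> b n j \<ge> 0"
    and b_zero: "\<And>n j. n \<ge> 1 \<Longrightarrow> j \<ge> 1 \<Longrightarrow> n \<ge> j \<Longrightarrow> b n j = 0"
  shows "(\<exists>w. weight w \<and> generates_analytic_substochastic w a b) \<and>
    ((\<forall>j\<ge>2. (\<Sum>n=1..j-1. real n * b n j) \<le> real j) \<longrightarrow>
      (\<forall>r>2. \<forall>w \<kappa>. w = (\<lambda>n. r ^ n) \<longrightarrow> \<kappa> = 2 / r \<longrightarrow>
        weight w \<and> generates_analytic_substochastic w a b \<and>
        (\<forall>j\<ge>2. (\<Sum>n=1..j-1. w n * b n j) \<le> \<kappa> * w j)))"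
proof (intro conjI impI allI)
  let ?w = "dominating_weight b"
  have "weight ?w" using dominating_weight_pos[OF b_nonneg] by (simp add: weight_def)
  moreover have "fragmentation a b ?w (1 / 2)"
  proof
    fix j :: nat
    show "(\<Sum>n\<in>{1..<j}. ?w n * b n j) \<le> 1 / 2 * ?w j"
      by (subst (2) dominating_weight.simps) simp
  qed (use \<open>weight ?w\<close> a_nonneg b_nonneg in auto)
  ultimately show "\<exists>w. weight w \<and> generates_analytic_substochastic w a b"
    using fragmentation.generates[of a b ?w "1 / 2"] by (intro exI[of _ ?w]) simp
next
  fix r :: real and w :: "nat \<Rightarrow> real" and \<kappa> :: real
  assume mass: "\<forall>j\<ge>2. (\<Sum>n=1..j-1. real n * b n j) \<le> real j"
    and r: "r > 2" and w: "w = (\<lambda>n. r ^ n)" and \<kappa>: "\<kappa> = 2 / r"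
  show weight: "weight w" using r by (simp add: weight_def w)
  show bound: "(\<Sum>n=1..j-1. w n * b n j) \<le> \<kappa> * w j" if "j \<ge> 2" for j
    using geometric_weight_bound[of r b j, OF r b_nonneg _ that] mass that by (simp add: w \<kappa>)
  have "fragmentation a b w \<kappa>"
  proof
    fix j :: nat assume "j \<ge> 1"
    show "(\<Sum>n\<in>{1..<j}. w n * b n j) \<le> \<kappa> * w j"
    \<comment> \<open>The locale also asks for column 1, where the sum is empty.\<close>
    proof (cases "j = 1")
      case False
      then have "{1..<j} = {1..j-1}" using \<open>j \<ge> 1\<close> by auto
      then show ?thesis using bound[of j] False \<open>j \<ge> 1\<close> by simp
    qed (use r in \<open>simp add: w \<kappa>\<close>)
  qed (use weight r a_nonneg b_nonneg in \<open>auto simp: \<kappa>\<close>)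
  then show "generates_analytic_substochastic w a b"
    by (rule fragmentation.generates)
qed

end
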